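(* Let $n\in\mathbb{N}$ and $F,G\in L^2(\Omega)$. Then $$\mathrm{Cov}(F,G)=\sum_{d=1}^{n}(-1)^{d+1}E\left[\sum_{0\le k_1<\cdots<k_d}(D_{k_d}\cdots D_{k_1}F)(D_{k_d}\cdots D_{k_1}G)\right]$$ $$\qquad+(-1)^nE\left[\sum_{0\le k_1<\cdots<k_{n+1}}(D_{k_{n+1}}\cdots D_{k_1}F)\,E\big[D_{k_{n+1}}\cdots D_{k_1}G\mid\mathcal{F}_{k_{n+1}-1}\big]\right].$$
   Context: $\mathbb{N}=\{0,1,2,\ldots\}$. Let $(p_k)_{k\in\mathbb{N}}$ be a deterministic sequence in $(0,1)$ and $q_k=1-p_k$. Let $\Omega=\{-1,1\}^{\mathbb{N}}$ with its product $\sigma$-algebra, let $X_k:\Omega\to\{-1,1\}$ be the canonical projections, and let $\mathbb{P}$ be the product probability measure under which the $X_k$ are independent with $\mathbb{P}(X_k=1)=p_k$, $\mathbb{P}(X_k=-1)=q_k$; $E$ denotes expectation under $\mathbb{P}$ and $L^2(\Omega)=L^2(\Omega,\mathbb{P})$. Set $\mathcal{F}_n=\sigma(X_0,\ldots,X_n)$ for $n\ge0$, $\mathcal{F}_{-1}=\{\emptyset,\Omega\}$. For $F:\Omega\to\mathbb{R}$ and $k\in\mathbb{N}$, $D_kF(\omega)=\sqrt{p_kq_k}\,(F(\omega_+^k)-F(\omega_-^k))$, where $\omega_\pm^k$ is $\omega$ with its $k$-th coordinate replaced by $\pm1$. $\mathrm{Cov}(F,G)=E[FG]-E[F]E[G]$.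 The inner sums run over all strictly increasing tuples of indices in $\mathbb{N}$; for $n=0$ the sum over $d$ is empty.
   Formalization: Convergence is added, as the right side can be ∞−∞: the identity is proved if the displayed series converge absolutely in mean, or with each E[Σ] read as an unconditionally convergent sum of expectations (for n=0 in that reading nothing beyond F,G in L² is assumed). *)

theory Defs
  imports "HOL-Probability.Probability"
begin

text \<open>The law on \<open>{-1, 1}\<close> with mass \<open>a\<close> at \<open>1\<close>.\<close>

definition bernoulli_pm :: "real \<Rightarrow> real measure" where
  "bernoulli_pm a = point_measure {-1, 1} (\<lambda>x. ennreal (if x = 1 then a else 1 - a))"

definition Omega :: "(nat \<Rightarrow> real) \<Rightarrow> (nat \<Rightarrow> real) measure" where
  "Omega p = PiM UNIV (\<lambda>k. bernoulli_pm (p k))"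

definition Expect :: "(nat \<Rightarrow> real) \<Rightarrow> ((nat \<Rightarrow> real) \<Rightarrow> real) \<Rightarrow> real" where
  "Expect p F = (\<integral>\<omega>. F \<omega> \<partial>Omega p)"

definition L2 :: "(nat \<Rightarrow> real) \<Rightarrow> ((nat \<Rightarrow> real) \<Rightarrow> real) set" where
  "L2 p = {F \<in> borel_measurable (Omega p). integrable (Omega p) (\<lambda>\<omega>. (F \<omega>)\<^sup>2)}"

definition Cov :: "(nat \<Rightarrow> real) \<Rightarrow> ((nat \<Rightarrow> real) \<Rightarrow> real) \<Rightarrow> ((nat \<Rightarrow> real) \<Rightarrow> real) \<Rightarrow> real" where
  "Cov p F G = Expect p (\<lambda>\<omega>. F \<omega> * G \<omega>) - Expect p F * Expect p G"

text \<open>The sigma-algebra generated by the coordinates with index at most \<open>m\<close>. The index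
  is an integer, so that \<open>m = -1\<close> gives the trivial sigma-algebra.\<close>

definition Filt :: "(nat \<Rightarrow> real) \<Rightarrow> int \<Rightarrow> (nat \<Rightarrow> real) measure" where
  "Filt p m = sigma (space (Omega p))
     {{\<omega> \<in> space (Omega p). \<omega> j \<in> A} | j A. int j \<le> m \<and> A \<subseteq> {-1, 1}}"

definition CondExpect ::
  "(nat \<Rightarrow> real) \<Rightarrow> int \<Rightarrow> ((nat \<Rightarrow> real) \<Rightarrow> real) \<Rightarrow> (nat \<Rightarrow> real) \<Rightarrow> real" where
  "CondExpect p m F = real_cond_exp (Omega p) (Filt p m) F"

definition Grad ::
  "(nat \<Rightarrow> real) \<Rightarrow> nat \<Rightarrow> ((nat \<Rightarrow> real) \<Rightarrow> real) \<Rightarrow> (nat \<Rightarrow> real) \<Rightarrow> real" where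
  "Grad p k F = (\<lambda>\<omega>. sqrt (p k * (1 - p k)) * (F (fun_upd \<omega> k 1) - F (fun_upd \<omega> k (-1))))"

text \<open>\<open>Grads p [k\<^sub>1, \<dots>, k\<^sub>d] F\<close> is \<open>D\<^bsub>k\<^sub>d\<^esub> \<dots> D\<^bsub>k\<^sub>1\<^esub> F\<close>: the head of the list acts first.\<close>

definition Grads ::
  "(nat \<Rightarrow> real) \<Rightarrow> nat list \<Rightarrow> ((nat \<Rightarrow> real) \<Rightarrow> real) \<Rightarrow> (nat \<Rightarrow> real) \<Rightarrow> real" where
  "Grads p ks F = fold (Grad p) ks F"

definition tuples :: "nat \<Rightarrow> nat list set" where
  "tuples d = {ks. length ks = d \<and> sorted_wrt (<) ks}"

lemma prob_space_bernoulli_pm: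
  assumes "0 < a" "a < 1"
  shows "prob_space (bernoulli_pm a)"
proof
  have "emeasure (bernoulli_pm a) (space (bernoulli_pm a)) =
      (\<Sum>x\<in>{-1, 1::real}. ennreal (if x = 1 then a else 1 - a))"
    unfolding bernoulli_pm_def by (subst emeasure_point_measure_finite) (auto simp: space_point_measure)
  also have "\<dots> = ennreal (1 - a) + ennreal a" by simp
  also have "\<dots> = 1" using assms by (simp flip: ennreal_plus)
  finally show "emeasure (bernoulli_pm a) (space (bernoulli_pm a)) = 1" .
qed

lemma prob_space_Omega:
  assumes "\<And>k. 0 < p k \<and> p k < 1"
  shows "prob_space (Omega p)"
  unfolding Omega_def using assms by (intro prob_space_PiM prob_space_bernoulli_pm) auto

lemma space_Omega: "space (Omega p) = {\<omega>. \<forall>k. \<omega> k \<in> {-1, 1}}"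
  by (auto simp: Omega_def space_PiM bernoulli_pm_def space_point_measure PiE_def Pi_def)

lemma subalgebra_Filt: "subalgebra (Omega p) (Filt p m)"
proof -
  have meas: "{\<omega> \<in> space (Omega p). \<omega> j \<in> A} \<in> sets (Omega p)" if "A \<subseteq> {-1, 1}" for j A
  proof -
    have 1: "(\<lambda>\<omega>. \<omega> j) \<in> measurable (Omega p) (bernoulli_pm (p j))"
      unfolding Omega_def by (rule measurable_component_singleton) auto
    have 2: "A \<in> sets (bernoulli_pm (p j))"
      using that by (simp add: bernoulli_pm_def sets_point_measure)
    from measurable_sets[OF 1 2] show ?thesis
      by (simp add: vimage_def Int_def conj_commute)
  qed
  let ?G = "{{\<omega> \<in> space (Omega p). \<omega> j \<in> A} | j A. int j \<le> m \<and> A \<subseteq> {-1, 1::real}}"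
  have gen: "?G \<subseteq> sets (Omega p)" using meas by blast
  have pow: "?G \<subseteq> Pow (space (Omega p))" by blast
  have "sets (Filt p m) = sigma_sets (space (Omega p)) ?G"
    unfolding Filt_def by (rule sets_measure_of[OF pow])
  moreover have "space (Filt p m) = space (Omega p)"
    unfolding Filt_def by (rule space_measure_of[OF pow])
  ultimately show ?thesis
    unfolding subalgebra_def using sets.sigma_sets_subset[OF gen] by simp
qed

end

theory Submission
  imports Defs
begin

text \<open>
  Write \<open>A = D\<^bsub>k\<^sub>d\<^esub> \<dots> D\<^bsub>k\<^sub>1\<^esub>F\<close> and \<open>B = D\<^bsub>k\<^sub>d\<^esub> \<dots> D\<^bsub>k\<^sub>1\<^esub>G\<close>. Since \<open>E[D\<^sub>lB | \<F>\<^bsub>l-1\<^esub>] = D\<^sub>l E[B | \<F>\<^sub>l]\<close>,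
  the product rule for the coordinate \<open>l\<close> gives
  \<open>E[D\<^sub>lA E[D\<^sub>lB | \<F>\<^bsub>l-1\<^esub>]] = E[A E[B | \<F>\<^sub>l]] - E[A E[B | \<F>\<^bsub>l-1\<^esub>]]\<close>. This telescopes, and
  \<open>E[B | \<F>\<^sub>N]\<close> tends to \<open>B\<close>, so the sum over \<open>l \<ge> m\<close> is \<open>E[AB] - E[A E[B | \<F>\<^bsub>m-1\<^esub>]]\<close>. For \<open>m = 0\<close>
  and \<open>d = 0\<close> this is the case \<open>n = 0\<close> of the theorem. For \<open>m = k\<^sub>d + 1\<close> one may replace
  \<open>\<F>\<^bsub>m-1\<^esub>\<close> by \<open>\<F>\<^bsub>m-2\<^esub>\<close>, because \<open>D\<^bsub>k\<^sub>d\<^esub>A = 0\<close>; hence the remainder of order \<open>d\<close> is the main term of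
  order \<open>d\<close> minus the remainder of order \<open>d + 1\<close>, and the theorem follows by induction on \<open>n\<close>.
\<close>

lemma abs_mult_le_weighted:
  fixes x y d :: real
  assumes "d > 0"
  shows "\<bar>x * y\<bar> \<le> d * x\<^sup>2 + y\<^sup>2 / d"
proof -
  have "0 \<le> (sqrt d * \<bar>x\<bar> - \<bar>y\<bar> / sqrt d)\<^sup>2" by simp
  also have "\<dots> = d * x\<^sup>2 + y\<^sup>2 / d - 2 * \<bar>x * y\<bar>"
    using assms by (simp add: power2_diff power_mult_distrib power_divide abs_mult)
  finally show ?thesis by simp
qed

lemma integral_infsum:
  fixes f :: "'i \<Rightarrow> 'a \<Rightarrow> real"
  assumes I: "countable I" and f: "\<And>i. i \<in> I \<Longrightarrow> integrable M (f i)"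
    and summable: "(\<lambda>i. \<integral>x. \<bar>f i x\<bar> \<partial>M) summable_on I"
  shows "(\<integral>x. (\<Sum>\<^sub>\<infinity>i\<in>I. f i x) \<partial>M) = (\<Sum>\<^sub>\<infinity>i\<in>I. \<integral>x. f i x \<partial>M)"
proof (cases "finite I")
  case True
  then show ?thesis using f by simp
next
  case False
  define h where "h = from_nat_into I"
  have bij: "bij_betw h UNIV I"
    unfolding h_def by (rule bij_betw_from_nat_into[OF I False])
  define g where "g n = f (h n)" for n
  have g: "integrable M (g n)" for n
    using f bij_betwE[OF bij] by (simp add: g_def)
  note [measurable] = borel_measurable_integrable[OF g]
  have "(\<lambda>n. \<integral>x. \<bar>g n x\<bar> \<partial>M) summable_on UNIV"
    using summable summable_on_reindex_bij_betw[OF bij, of "\<lambda>i. \<integral>x. \<bar>f i x\<bar> \<partial>M"]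
    by (simp add: g_def)
  then have sum_g: "Series.summable (\<lambda>n. \<integral>x. norm (g n x) \<partial>M)"
    by (simp add: summable_on_imp_summable)
  define A where "A x = (\<Sum>n. ennreal \<bar>g n x\<bar>)" for x
  have A [measurable]: "A \<in> borel_measurable M" unfolding A_def by measurable
  have "(\<integral>\<^sup>+x. A x \<partial>M) = (\<Sum>n. \<integral>\<^sup>+x. ennreal \<bar>g n x\<bar> \<partial>M)"
    unfolding A_def by (rule nn_integral_suminf) measurable
  also have "\<dots> = (\<Sum>n. ennreal (\<integral>x. \<bar>g n x\<bar> \<partial>M))"
    using g by (intro suminf_cong nn_integral_eq_integral) auto
  also have "\<dots> \<noteq> \<infinity>"
    using sum_g by (simp add: ennreal_suminf_neq_top)
  finally have "AE x in M. A x \<noteq> \<infinity>"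
    by (intro nn_integral_noteq_infinite) auto
  moreover have abs: "Series.summable (\<lambda>n. norm (g n x)) \<longleftrightarrow> A x \<noteq> \<infinity>" for x
    unfolding A_def by (auto simp: ennreal_suminf_neq_top intro: summable_suminf_not_top)
  ultimately have AE: "AE x in M. Series.summable (\<lambda>n. norm (g n x))" by (simp only:)
  have infsum: "(\<Sum>\<^sub>\<infinity>i\<in>I. f i x) = (if A x \<noteq> \<infinity> then \<Sum>n. g n x else 0)" for x
  proof -
    have "(\<Sum>\<^sub>\<infinity>i\<in>I. f i x) = (\<Sum>\<^sub>\<infinity>n. g n x)"
      unfolding g_def using infsum_reindex_bij_betw[OF bij, of "\<lambda>i. f i x"] by simp
    also have "\<dots> = (if A x \<noteq> \<infinity> then \<Sum>n. g n x else 0)"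
    proof (cases "A x = \<infinity>")
      case False
      then have "Series.summable (\<lambda>n. norm (g n x))" using abs by blast
      from norm_summable_imp_has_sum[OF this summable_sums[OF summable_norm_cancel[OF this]]]
      show ?thesis using False by (simp add: infsumI)
    next
      case True
      then have "\<not> (\<lambda>n. g n x) summable_on UNIV"
        using abs[of x] summable_on_iff_abs_summable_on_real[of "\<lambda>n. g n x" UNIV]
        by (auto dest: summable_on_imp_summable)
      then show ?thesis using True by (simp add: infsum_not_exists)
    qed
    finally show ?thesis .
  qed
  have "(\<integral>x. (\<Sum>\<^sub>\<infinity>i\<in>I. f i x) \<partial>M) = (\<integral>x. (\<Sum>n. g n x) \<partial>M)"
  proof (rule integral_cong_AE)
    show "AE x in M. (\<Sum>\<^sub>\<infinity>i\<in>I. f i x) = (\<Sum>n. g n x)"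
      using AE unfolding abs by eventually_elim (simp add: infsum)
  qed (simp_all add: infsum)
  also have "(\<lambda>n. \<integral>x. g n x \<partial>M) sums \<dots>"
    using g AE sum_g by (rule sums_integral)
  finally have sums: "(\<lambda>n. \<integral>x. g n x \<partial>M) sums (\<integral>x. (\<Sum>\<^sub>\<infinity>i\<in>I. f i x) \<partial>M)" .
  have "Series.summable (\<lambda>n. norm (\<integral>x. g n x \<partial>M))"
    by (rule summable_comparison_test'[OF sum_g]) (use integral_norm_bound[of M] in auto)
  from infsumI[OF norm_summable_imp_has_sum[OF this sums]]
  show ?thesis
    using infsum_reindex_bij_betw[OF bij, of "\<lambda>i. \<integral>x. f i x \<partial>M"] by (simp add: g_def)
qed

lemma Grads_snoc: "Grads p (ks @ [l]) F = Grad p l (Grads p ks F)"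
  by (simp add: Grads_def)

lemma Grad_Grad_same: "Grad p l (Grad p l F) = (\<lambda>_. 0)"
  by (simp add: Grad_def)

lemma Grad_last_Grads: "ks \<noteq> [] \<Longrightarrow> Grad p (last ks) (Grads p ks F) = (\<lambda>_. 0)"
  by (cases ks rule: rev_cases) (simp_all add: Grads_snoc Grad_Grad_same)

lemma tuples_not_Nil: "ks \<in> tuples (Suc d) \<Longrightarrow> ks \<noteq> []"
  by (auto simp: tuples_def)

lemma bij_betw_tuples_1: "bij_betw (\<lambda>l. [l]) UNIV (tuples (Suc 0))"
  by (rule bij_betwI[where g = hd]) (auto simp: tuples_def length_Suc_conv)

lemma bij_betw_tuples_Suc:
  "bij_betw (\<lambda>(ks, l). ks @ [l]) (SIGMA ks:tuples (Suc d). {Suc (last ks)..}) (tuples (Suc (Suc d)))"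
proof (rule bij_betwI[where g = "\<lambda>ks. (butlast ks, last ks)"])
  have "k \<le> last ks" if "sorted_wrt (<) ks" "k \<in> set ks" for k :: nat and ks
    using that by (cases ks rule: rev_cases) (auto simp: sorted_wrt_append)
  then show "(\<lambda>(ks, l). ks @ [l]) \<in>
      (SIGMA ks:tuples (Suc d). {Suc (last ks)..}) \<rightarrow> tuples (Suc (Suc d))"
    by (fastforce simp: tuples_def sorted_wrt_append)
  show "(\<lambda>ks. (butlast ks, last ks)) \<in>
      tuples (Suc (Suc d)) \<rightarrow> (SIGMA ks:tuples (Suc d). {Suc (last ks)..})"
  proof
    fix ks assume ks: "ks \<in> tuples (Suc (Suc d))"
    then obtain ks' l where *: "ks = ks' @ [l]" by (cases ks rule: rev_cases) (auto simp: tuples_def)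
    with ks have "ks' \<noteq> []" by (auto simp: tuples_def)
    moreover have "\<forall>x\<in>set ks'. x < l" using ks * by (auto simp: tuples_def sorted_wrt_append)
    ultimately have "last ks' < l" using last_in_set by blast
    with ks * show "(butlast ks, last ks) \<in> (SIGMA ks:tuples (Suc d). {Suc (last ks)..})"
      by (auto simp: tuples_def sorted_wrt_append)
  qed
qed (auto simp: tuples_def intro!: append_butlast_last_id)

section \<open>Integration over a single coordinate\<close>

locale coin_tossing =
  fixes p :: "nat \<Rightarrow> real"
  assumes p_bounds: "\<And>k. 0 < p k \<and> p k < 1"
begin

abbreviation "M \<equiv> Omega p"

sublocale prob_space M
  using p_bounds by (rule prob_space_Omega)

lemma measurable_upd [measurable]:
  assumes "x \<in> {-1, 1}"
  shows "(\<lambda>\<omega>. fun_upd \<omega> k x) \<in> measurable M M"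
proof -
  have "(\<lambda>\<omega>. fun_upd (id \<omega>) k x) \<in> measurable M M"
    unfolding Omega_def
    by (rule measurable_fun_upd[where J = UNIV])
      (use assms in \<open>auto simp: bernoulli_pm_def space_point_measure\<close>)
  then show ?thesis by simp
qed

lemma nn_integral_upd:
  assumes [measurable]: "f \<in> borel_measurable M"
  shows "(\<integral>\<^sup>+\<omega>. f \<omega> \<partial>M) =
    p k * (\<integral>\<^sup>+\<omega>. f (fun_upd \<omega> k 1) \<partial>M) + (1 - p k) * (\<integral>\<^sup>+\<omega>. f (fun_upd \<omega> k (-1)) \<partial>M)"
proof -
  let ?B = "bernoulli_pm (p k)" and ?u = "\<lambda>(x, \<omega>). fun_upd (\<omega> :: nat \<Rightarrow> real) k x"
  have distr: "distr (?B \<Otimes>\<^sub>M M) M ?u = M"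
    using distr_pair_PiM_eq_PiM[of UNIV "\<lambda>k. bernoulli_pm (p k)" k] p_bounds
    by (simp add: Omega_def prob_space_bernoulli_pm)
  have u [measurable]: "?u \<in> measurable (?B \<Otimes>\<^sub>M M) M"
    unfolding Omega_def case_prod_beta by (rule measurable_fun_upd[where J = UNIV]) auto
  have "(\<integral>\<^sup>+\<omega>. f \<omega> \<partial>M) = (\<integral>\<^sup>+z. f (?u z) \<partial>(?B \<Otimes>\<^sub>M M))"
    by (subst distr[symmetric], subst nn_integral_distr) auto
  also have "\<dots> = (\<integral>\<^sup>+x. \<integral>\<^sup>+\<omega>. f (?u (x, \<omega>)) \<partial>M \<partial>?B)"
    by (rule nn_integral_fst[symmetric]) simp
  also have "\<dots> = (\<Sum>x\<in>{-1, 1}. (if x = 1 then p k else 1 - p k) * (\<integral>\<^sup>+\<omega>. f (fun_upd \<omega> k x) \<partial>M))"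
    unfolding bernoulli_pm_def by (subst nn_integral_point_measure_finite) (auto simp: mult_ac)
  finally show ?thesis by (simp add: add.commute)
qed

lemma integrable_upd:
  fixes f :: "(nat \<Rightarrow> real) \<Rightarrow> real"
  assumes f: "integrable M f" and x: "x \<in> {-1, 1}"
  shows "integrable M (\<lambda>\<omega>. f (fun_upd \<omega> k x))"
proof -
  note [measurable] = borel_measurable_integrable[OF f]
  let ?I = "\<lambda>x. \<integral>\<^sup>+\<omega>. norm (f (fun_upd \<omega> k x)) \<partial>M"
  have "p k * ?I 1 + (1 - p k) * ?I (-1) < \<infinity>"
    using f unfolding integrable_iff_bounded
    by (subst nn_integral_upd[of "\<lambda>\<omega>. norm (f \<omega>)", symmetric]) auto
  then have "?I x < \<infinity>"
    using x p_bounds[of k] by (auto simp: less_top[symmetric] ennreal_mult_eq_top_iff)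
  moreover have "(\<lambda>\<omega>. f (fun_upd \<omega> k x)) \<in> borel_measurable M"
    using x by measurable
  ultimately show ?thesis by (simp add: integrable_iff_bounded)
qed

lemma integral_upd:
  fixes f :: "(nat \<Rightarrow> real) \<Rightarrow> real"
  assumes f: "integrable M f"
  shows "(\<integral>\<omega>. f \<omega> \<partial>M) = (\<integral>\<omega>. p k * f (fun_upd \<omega> k 1) + (1 - p k) * f (fun_upd \<omega> k (-1)) \<partial>M)"
proof -
  have *: "(\<integral>\<omega>. g \<omega> \<partial>M) =
      p k * (\<integral>\<omega>. g (fun_upd \<omega> k 1) \<partial>M) + (1 - p k) * (\<integral>\<omega>. g (fun_upd \<omega> k (-1)) \<partial>M)"
    if g: "integrable M g" "\<And>\<omega>. 0 \<le> g \<omega>" for g :: "(nat \<Rightarrow> real) \<Rightarrow> real"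
  proof -
    note [measurable] = borel_measurable_integrable[OF g(1)]
    have "ennreal (\<integral>\<omega>. g \<omega> \<partial>M) = p k * ennreal (\<integral>\<omega>. g (fun_upd \<omega> k 1) \<partial>M) +
        (1 - p k) * ennreal (\<integral>\<omega>. g (fun_upd \<omega> k (-1)) \<partial>M)"
      using g nn_integral_upd[of "\<lambda>\<omega>. ennreal (g \<omega>)" k]
      by (simp add: nn_integral_eq_integral integrable_upd)
    also have "\<dots> = ennreal (p k * (\<integral>\<omega>. g (fun_upd \<omega> k 1) \<partial>M) +
        (1 - p k) * (\<integral>\<omega>. g (fun_upd \<omega> k (-1)) \<partial>M))"
      using p_bounds[of k] g
      by (simp add: ennreal_mult' ennreal_plus integral_nonneg_AE)
    finally show ?thesis
      using p_bounds[of k] g by (subst (asm) ennreal_inj) (auto intro!: integral_nonneg_AE)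
  qed
  have pos: "integrable M (\<lambda>\<omega>. max (f \<omega>) 0)" and neg: "integrable M (\<lambda>\<omega>. max (- f \<omega>) 0)"
    using f by auto
  note int = integrable_upd[OF pos, of _ k] integrable_upd[OF neg, of _ k] integrable_upd[OF f, of _ k]
  have dec: "f \<omega> = max (f \<omega>) 0 - max (- f \<omega>) 0" for \<omega> by auto
  have "(\<integral>\<omega>. f \<omega> \<partial>M) = (\<integral>\<omega>. max (f \<omega>) 0 \<partial>M) - (\<integral>\<omega>. max (- f \<omega>) 0 \<partial>M)"
    by (subst dec) (rule Bochner_Integration.integral_diff[OF pos neg])
  also have "\<dots> = p k * ((\<integral>\<omega>. max (f (fun_upd \<omega> k 1)) 0 \<partial>M) - (\<integral>\<omega>. max (- f (fun_upd \<omega> k 1)) 0 \<partial>M)) +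
      (1 - p k) * ((\<integral>\<omega>. max (f (fun_upd \<omega> k (-1))) 0 \<partial>M) - (\<integral>\<omega>. max (- f (fun_upd \<omega> k (-1))) 0 \<partial>M))"
    using *[OF pos] *[OF neg] by (simp add: algebra_simps)
  also have "\<dots> = p k * (\<integral>\<omega>. f (fun_upd \<omega> k 1) \<partial>M) + (1 - p k) * (\<integral>\<omega>. f (fun_upd \<omega> k (-1)) \<partial>M)"
  proof -
    have "(\<integral>\<omega>. f (fun_upd \<omega> k x) \<partial>M) =
        (\<integral>\<omega>. max (f (fun_upd \<omega> k x)) 0 - max (- f (fun_upd \<omega> k x)) 0 \<partial>M)" for x
      by (rule Bochner_Integration.integral_cong) auto
    moreover have "(\<integral>\<omega>. max (f (fun_upd \<omega> k x)) 0 - max (- f (fun_upd \<omega> k x)) 0 \<partial>M) =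
        (\<integral>\<omega>. max (f (fun_upd \<omega> k x)) 0 \<partial>M) - (\<integral>\<omega>. max (- f (fun_upd \<omega> k x)) 0 \<partial>M)"
      if "x \<in> {-1, 1}" for x
      using int that by (intro Bochner_Integration.integral_diff) auto
    ultimately have "(\<integral>\<omega>. f (fun_upd \<omega> k x) \<partial>M) =
        (\<integral>\<omega>. max (f (fun_upd \<omega> k x)) 0 \<partial>M) - (\<integral>\<omega>. max (- f (fun_upd \<omega> k x)) 0 \<partial>M)"
      if "x \<in> {-1, 1}" for x
      using that by simp
    then show ?thesis by simp
  qed
  finally show ?thesis
    using int by simp
qed

abbreviation cond :: "nat \<Rightarrow> ((nat \<Rightarrow> real) \<Rightarrow> real) \<Rightarrow> (nat \<Rightarrow> real) \<Rightarrow> real" where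
  "cond l \<equiv> CondExpect p (int l - 1)"

definition avg :: "nat \<Rightarrow> ((nat \<Rightarrow> real) \<Rightarrow> real) \<Rightarrow> (nat \<Rightarrow> real) \<Rightarrow> real" where
  "avg k F = (\<lambda>\<omega>. p k * F (fun_upd \<omega> k 1) + (1 - p k) * F (fun_upd \<omega> k (-1)))"

text \<open>Normalized so that averaging over the coordinate \<open>k\<close> gives \<open>0\<close> and \<open>D\<^sub>k\<close> gives \<open>1\<close>;
  testing against it extracts the gradient.\<close>

definition noise :: "nat \<Rightarrow> (nat \<Rightarrow> real) \<Rightarrow> real" where
  "noise k \<omega> = (\<omega> k - (2 * p k - 1)) / (2 * sqrt (p k * (1 - p k)))"

lemma L2_measurable [measurable_dest]: "F \<in> L2 p \<Longrightarrow> F \<in> borel_measurable M"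
  by (simp add: L2_def)

lemma L2_square_integrable: "F \<in> L2 p \<Longrightarrow> integrable M (\<lambda>\<omega>. (F \<omega>)\<^sup>2)"
  by (simp add: L2_def)

lemma L2_bounded:
  assumes "F \<in> borel_measurable M" and "\<And>\<omega>. \<omega> \<in> space M \<Longrightarrow> \<bar>F \<omega>\<bar> \<le> B"
  shows "F \<in> L2 p"
proof -
  have "norm ((F \<omega>)\<^sup>2) \<le> B\<^sup>2" if "\<omega> \<in> space M" for \<omega>
    using assms(2)[OF that] abs_le_square_iff[of "F \<omega>" B] by simp
  then show ?thesis
    using assms(1) by (auto simp: L2_def intro!: integrable_const_bound[where B = "B\<^sup>2"])
qed

lemma L2_mult_integrable:
  assumes F: "F \<in> L2 p" and G: "G \<in> L2 p"
  shows "integrable M (\<lambda>\<omega>. F \<omega> * G \<omega>)"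
proof (rule Bochner_Integration.integrable_bound)
  show "integrable M (\<lambda>\<omega>. (F \<omega>)\<^sup>2 + (G \<omega>)\<^sup>2)"
    using F G by (simp add: L2_def)
  show "(\<lambda>\<omega>. F \<omega> * G \<omega>) \<in> borel_measurable M"
    using F G by measurable
  show "AE \<omega> in M. norm (F \<omega> * G \<omega>) \<le> norm ((F \<omega>)\<^sup>2 + (G \<omega>)\<^sup>2)"
  proof (rule AE_I2)
    fix \<omega>
    have "\<bar>F \<omega> * G \<omega>\<bar> \<le> 2 * \<bar>F \<omega>\<bar> * \<bar>G \<omega>\<bar>"
      by (simp add: abs_mult)
    also have "\<dots> \<le> (F \<omega>)\<^sup>2 + (G \<omega>)\<^sup>2"
      using sum_squares_bound[of "\<bar>F \<omega>\<bar>" "\<bar>G \<omega>\<bar>"] by simp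
    finally show "norm (F \<omega> * G \<omega>) \<le> norm ((F \<omega>)\<^sup>2 + (G \<omega>)\<^sup>2)"
      by simp
  qed
qed

lemma L2_const: "(\<lambda>_. c) \<in> L2 p"
  by (rule L2_bounded[where B = "\<bar>c\<bar>"]) auto

lemma L2_integrable: "F \<in> L2 p \<Longrightarrow> integrable M F"
  using L2_mult_integrable[OF _ L2_const[of 1]] by simp

lemma L2_cmult: "F \<in> L2 p \<Longrightarrow> (\<lambda>\<omega>. c * F \<omega>) \<in> L2 p"
  by (auto simp: L2_def power_mult_distrib)

lemma L2_add:
  assumes F: "F \<in> L2 p" and G: "G \<in> L2 p"
  shows "(\<lambda>\<omega>. F \<omega> + G \<omega>) \<in> L2 p"
proof -
  have "integrable M (\<lambda>\<omega>. (F \<omega>)\<^sup>2 + (G \<omega>)\<^sup>2 + 2 * (F \<omega> * G \<omega>))"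
    using F G L2_mult_integrable[OF F G] by (simp add: L2_def)
  then show ?thesis
    using borel_measurable_add[OF L2_measurable[OF F] L2_measurable[OF G]]
    by (simp add: L2_def power2_sum mult.assoc)
qed

lemma L2_diff:
  assumes F: "F \<in> L2 p" and G: "G \<in> L2 p"
  shows "(\<lambda>\<omega>. F \<omega> - G \<omega>) \<in> L2 p"
  using L2_add[OF F L2_cmult[OF G, of "-1"]] by simp

lemma L2_upd:
  assumes "F \<in> L2 p" "x \<in> {-1, 1}"
  shows "(\<lambda>\<omega>. F (fun_upd \<omega> k x)) \<in> L2 p"
  using assms measurable_compose[OF measurable_upd, of x F borel]
    integrable_upd[OF L2_square_integrable, of F x k]
  by (simp add: L2_def)

lemma L2_Grad: "F \<in> L2 p \<Longrightarrow> Grad p k F \<in> L2 p"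
  unfolding Grad_def by (intro L2_cmult L2_diff L2_upd) auto

lemma L2_Grads: "F \<in> L2 p \<Longrightarrow> Grads p ks F \<in> L2 p"
  unfolding Grads_def by (induction ks arbitrary: F) (auto intro: L2_Grad)

lemma L2_avg: "F \<in> L2 p \<Longrightarrow> avg k F \<in> L2 p"
  unfolding avg_def by (intro L2_add L2_cmult L2_upd) auto

text \<open>The product rule \<open>E\<^sub>k[FG] = E\<^sub>k[F] E\<^sub>k[G] + D\<^sub>kF D\<^sub>kG\<close> for the average \<open>E\<^sub>k\<close> over the
  coordinate \<open>k\<close>, integrated.\<close>

lemma integral_mult_split:
  assumes F: "F \<in> L2 p" and G: "G \<in> L2 p"
  shows "(\<integral>\<omega>. F \<omega> * G \<omega> \<partial>M) =
    (\<integral>\<omega>. F \<omega> * avg k G \<omega> \<partial>M) + (\<integral>\<omega>. Grad p k F \<omega> * Grad p k G \<omega> \<partial>M)"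
proof -
  let ?q = "1 - p k"
  have pq: "sqrt (p k * ?q) * a * (sqrt (p k * ?q) * b) = p k * ?q * a * b" for a b
  proof -
    have "sqrt (p k * ?q) * a * (sqrt (p k * ?q) * b) = (sqrt (p k * ?q))\<^sup>2 * a * b"
      by (simp add: power2_eq_square mult_ac)
    then show ?thesis using p_bounds[of k] by simp
  qed
  have *: "p k * (a * c) + ?q * (b * d) = (p k * a + ?q * b) * (p k * c + ?q * d) +
      p k * ?q * (a - b) * (c - d)" for a b c d
    by (simp add: algebra_simps)
  have "(\<integral>\<omega>. F \<omega> * G \<omega> \<partial>M) = (\<integral>\<omega>. p k * (F (fun_upd \<omega> k 1) * G (fun_upd \<omega> k 1)) +
      ?q * (F (fun_upd \<omega> k (-1)) * G (fun_upd \<omega> k (-1))) \<partial>M)"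
    by (rule integral_upd[OF L2_mult_integrable[OF F G]])
  also have "\<dots> = (\<integral>\<omega>. avg k F \<omega> * avg k G \<omega> + Grad p k F \<omega> * Grad p k G \<omega> \<partial>M)"
    unfolding * avg_def Grad_def pq ..
  also have "\<dots> = (\<integral>\<omega>. avg k F \<omega> * avg k G \<omega> \<partial>M) + (\<integral>\<omega>. Grad p k F \<omega> * Grad p k G \<omega> \<partial>M)"
    using F G by (intro Bochner_Integration.integral_add L2_mult_integrable L2_avg L2_Grad)
  also have "(\<integral>\<omega>. avg k F \<omega> * avg k G \<omega> \<partial>M) = (\<integral>\<omega>. F \<omega> * avg k G \<omega> \<partial>M)"
    using integral_upd[OF L2_mult_integrable[OF F L2_avg[OF G]], of k k]
    by (simp add: avg_def distrib_right mult.assoc)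
  finally show ?thesis .
qed

section \<open>Conditional expectations and gradients\<close>

lemma space_Filt: "space (Filt p m) = space M"
  using subalgebra_Filt[of p m] by (simp add: subalgebra_def)

lemma sets_Filt: "sets (Filt p m) = sigma_sets (space M)
    {{\<omega> \<in> space M. \<omega> j \<in> A} | j A. int j \<le> m \<and> A \<subseteq> {-1, 1}}"
  unfolding Filt_def by (rule sets_measure_of) blast

lemma measurable_Filt_imp: "f \<in> borel_measurable (Filt p m) \<Longrightarrow> f \<in> borel_measurable M"
  by (rule measurable_from_subalg[OF subalgebra_Filt])

lemma sigma_finite_subalgebra_Filt: "sigma_finite_subalgebra M (Filt p m)"
  by (intro finite_measure_subalgebra_is_sigma_finite finite_measure_subalgebra.intro
      finite_measure_subalgebra_axioms.intro finite_measure_axioms subalgebra_Filt)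

lemma subalgebra_Filt_mono: "m \<le> m' \<Longrightarrow> subalgebra (Filt p m') (Filt p m)"
  unfolding subalgebra_def space_Filt sets_Filt
  by (intro conjI refl sigma_sets_mono') (blast intro: order_trans)

lemma coordinate_in_Filt:
  "int j \<le> m \<Longrightarrow> A \<subseteq> {-1, 1} \<Longrightarrow> {\<omega> \<in> space M. \<omega> j \<in> A} \<in> sets (Filt p m)"
  unfolding sets_Filt by (rule sigma_sets.Basic) blast

lemma measurable_coordinate [measurable]: "(\<lambda>\<omega>. \<omega> k) \<in> borel_measurable (Filt p (int k))"
proof (rule measurableI)
  fix A :: "real set"
  have "(\<lambda>\<omega>. \<omega> k) -` A \<inter> space (Filt p (int k)) = {\<omega> \<in> space M. \<omega> k \<in> A \<inter> {-1, 1}}"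
    by (auto simp: space_Filt space_Omega)
  also have "\<dots> \<in> sets (Filt p (int k))"
    by (rule coordinate_in_Filt) auto
  finally show "(\<lambda>\<omega>. \<omega> k) -` A \<inter> space (Filt p (int k)) \<in> sets (Filt p (int k))" .
qed simp

lemma measurable_noise: "noise k \<in> borel_measurable (Filt p (int k))"
  unfolding noise_def by measurable

lemma noise_L2: "noise k \<in> L2 p"
proof (rule L2_bounded)
  show "noise k \<in> borel_measurable M"
    by (rule measurable_Filt_imp[OF measurable_noise])
  fix \<omega> assume "\<omega> \<in> space M"
  then have "\<omega> k = -1 \<or> \<omega> k = 1" by (auto simp: space_Omega)
  then have "\<bar>\<omega> k - (2 * p k - 1)\<bar> \<le> 2"
    using p_bounds[of k] by linarith
  moreover have "0 < sqrt (p k * (1 - p k))"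
    using p_bounds[of k] by simp
  ultimately show "\<bar>noise k \<omega>\<bar> \<le> 1 / sqrt (p k * (1 - p k))"
    by (simp add: noise_def field_simps)
qed

lemma upd_space: "\<omega> \<in> space M \<Longrightarrow> x \<in> {-1, 1} \<Longrightarrow> fun_upd \<omega> k x \<in> space M"
  by (auto simp: space_Omega)

lemma Filt_invariant_set:
  assumes S: "S \<in> sets (Filt p m)" and k: "m < int k" and x: "x \<in> {-1, 1}" and \<omega>: "\<omega> \<in> space M"
  shows "fun_upd \<omega> k x \<in> S \<longleftrightarrow> \<omega> \<in> S"
  using S unfolding sets_Filt
proof (induction rule: sigma_sets.induct)
  case (Basic a)
  then obtain j A where a: "a = {\<omega> \<in> space M. \<omega> j \<in> A}" and "int j \<le> m" by auto
  then have "fun_upd \<omega> k x j = \<omega> j" using k by auto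
  with upd_space[OF \<omega> x, of k] \<omega> show ?case unfolding a mem_Collect_eq by metis
next
  case (Compl a)
  then show ?case using upd_space[OF \<omega> x, of k] \<omega> by blast
qed blast+

lemma measurable_upd_Filt:
  assumes x: "x \<in> {-1, 1}"
  shows "(\<lambda>\<omega>. fun_upd \<omega> k x) \<in> measurable (Filt p (int k - 1)) (Filt p (int k))"
  unfolding Filt_def[of p "int k"]
proof (rule measurable_measure_of)
  show "(\<lambda>\<omega>. fun_upd \<omega> k x) \<in> space (Filt p (int k - 1)) \<rightarrow> space M"
    using x by (auto simp: space_Filt upd_space)
  fix S assume "S \<in> {{\<omega> \<in> space M. \<omega> j \<in> A} | j A. int j \<le> int k \<and> A \<subseteq> {-1, 1}}"
  then obtain j A where S: "S = {\<omega> \<in> space M. \<omega> j \<in> A}" "j \<le> k" "A \<subseteq> {-1, 1}" by auto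
  have eq: "(\<lambda>\<omega>. fun_upd \<omega> k x) -` S \<inter> space (Filt p (int k - 1)) =
      (if j = k then if x \<in> A then space M else {} else S)"
    using S x by (auto simp: space_Filt upd_space)
  show "(\<lambda>\<omega>. fun_upd \<omega> k x) -` S \<inter> space (Filt p (int k - 1)) \<in> sets (Filt p (int k - 1))"
  proof (cases "j = k")
    case True
    then show ?thesis
      unfolding eq using sets.top[of "Filt p (int k - 1)"] by (simp add: space_Filt)
  next
    case False
    then have "S \<in> sets (Filt p (int k - 1))"
      unfolding S(1) using S by (intro coordinate_in_Filt) auto
    then show ?thesis unfolding eq using False by simp
  qed
qed blast

lemma borel_measurable_cond:
  "CondExpect p m F \<in> borel_measurable (Filt p m)" "CondExpect p m F \<in> borel_measurable M"
  unfolding CondExpect_def by simp_all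

lemma L2_cond:
  assumes F: "F \<in> L2 p"
  shows "CondExpect p m F \<in> L2 p"
proof -
  interpret sigma_finite_subalgebra M "Filt p m" by (rule sigma_finite_subalgebra_Filt)
  have "integrable M (\<lambda>\<omega>. (real_cond_exp M (Filt p m) F \<omega>)\<^sup>2)"
    using L2_integrable[OF F] L2_square_integrable[OF F]
    by (intro integrable_convex_cond_exp[where I = UNIV and q = "\<lambda>x. x\<^sup>2"] convex_power2) auto
  then show ?thesis
    by (simp add: L2_def CondExpect_def)
qed

lemma integral_mult_cond:
  assumes F: "F \<in> L2 p" "F \<in> borel_measurable (Filt p m)" and G: "G \<in> L2 p"
  shows "(\<integral>\<omega>. F \<omega> * CondExpect p m G \<omega> \<partial>M) = (\<integral>\<omega>. F \<omega> * G \<omega> \<partial>M)"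
proof -
  interpret sigma_finite_subalgebra M "Filt p m" by (rule sigma_finite_subalgebra_Filt)
  show ?thesis
    unfolding CondExpect_def
    using real_cond_exp_intg(2)[OF L2_mult_integrable[OF F(1) G] F(2)] G by measurable
qed

lemma integral_mult_cond':
  assumes F: "F \<in> L2 p" and G: "G \<in> L2 p"
  shows "(\<integral>\<omega>. F \<omega> * CondExpect p m G \<omega> \<partial>M) =
    (\<integral>\<omega>. CondExpect p m F \<omega> * CondExpect p m G \<omega> \<partial>M)"
  using integral_mult_cond[OF L2_cond[OF G] borel_measurable_cond(1) F, of m]
  by (simp add: mult.commute)

lemma cond_charact:
  assumes F: "F \<in> L2 p" and G: "G \<in> L2 p" "G \<in> borel_measurable (Filt p m)"
    and eq: "\<And>S. S \<in> sets (Filt p m) \<Longrightarrow>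
      (\<integral>\<omega>. indicator S \<omega> * F \<omega> \<partial>M) = (\<integral>\<omega>. indicator S \<omega> * G \<omega> \<partial>M)"
  shows "AE \<omega> in M. CondExpect p m F \<omega> = G \<omega>"
proof -
  interpret sigma_finite_subalgebra M "Filt p m" by (rule sigma_finite_subalgebra_Filt)
  show ?thesis
    unfolding CondExpect_def
    by (rule real_cond_exp_charact) (use F G L2_integrable eq in \<open>auto simp: set_lebesgue_integral_def\<close>)
qed

lemma L2_indicator: "S \<in> sets (Filt p m) \<Longrightarrow> indicator S \<in> L2 p"
  using subalgebra_Filt[of p m]
  by (intro L2_bounded[where B = 1]) (auto simp: subalgebra_def indicator_def)

lemma avg_cond:
  assumes B: "B \<in> L2 p"
  shows "AE \<omega> in M. cond l B \<omega> = avg l (CondExpect p (int l) B) \<omega>"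
proof (rule cond_charact)
  let ?H = "CondExpect p (int l) B"
  have H: "?H \<in> L2 p" using B by (rule L2_cond)
  show "avg l ?H \<in> L2 p" using H by (rule L2_avg)
  have "(\<lambda>\<omega>. ?H (fun_upd \<omega> l x)) \<in> borel_measurable (Filt p (int l - 1))" if "x \<in> {-1, 1}" for x
    using measurable_compose[OF measurable_upd_Filt[OF that] borel_measurable_cond(1)] .
  then show "avg l ?H \<in> borel_measurable (Filt p (int l - 1))"
    unfolding avg_def by (intro borel_measurable_add borel_measurable_times) auto
  fix S assume S: "S \<in> sets (Filt p (int l - 1))"
  then have S': "S \<in> sets (Filt p (int l))"
    using subalgebra_Filt_mono[of "int l - 1" "int l"] by (auto simp: subalgebra_def)
  have "Grad p l (indicator S) \<omega> = 0" if "\<omega> \<in> space M" for \<omega>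
    using Filt_invariant_set[OF S, of l] that by (simp add: Grad_def indicator_def)
  then have 0: "(\<integral>\<omega>. Grad p l (indicator S) \<omega> * Grad p l ?H \<omega> \<partial>M) = 0"
    by (subst Bochner_Integration.integral_cong[where g = "\<lambda>_. 0"]) auto
  have "(\<integral>\<omega>. indicator S \<omega> * B \<omega> \<partial>M) = (\<integral>\<omega>. indicator S \<omega> * ?H \<omega> \<partial>M)"
    using integral_mult_cond[OF L2_indicator[OF S'] _ B] S' by simp
  also have "\<dots> = (\<integral>\<omega>. indicator S \<omega> * avg l ?H \<omega> \<partial>M)"
    using integral_mult_split[OF L2_indicator[OF S'] H, of l] 0 by simp
  finally show "(\<integral>\<omega>. indicator S \<omega> * B \<omega> \<partial>M) = (\<integral>\<omega>. indicator S \<omega> * avg l ?H \<omega> \<partial>M)" .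
qed fact

lemma Grad_cond:
  assumes B: "B \<in> L2 p"
  shows "AE \<omega> in M. cond l (Grad p l B) \<omega> = Grad p l (CondExpect p (int l) B) \<omega>"
proof (rule cond_charact)
  let ?H = "CondExpect p (int l) B"
  have H: "?H \<in> L2 p" using B by (rule L2_cond)
  show "Grad p l ?H \<in> L2 p" "Grad p l B \<in> L2 p" using H B by (auto intro: L2_Grad)
  have "(\<lambda>\<omega>. ?H (fun_upd \<omega> l x)) \<in> borel_measurable (Filt p (int l - 1))" if "x \<in> {-1, 1}" for x
    using measurable_compose[OF measurable_upd_Filt[OF that] borel_measurable_cond(1)] .
  then show "Grad p l ?H \<in> borel_measurable (Filt p (int l - 1))"
    unfolding Grad_def by (intro borel_measurable_diff borel_measurable_times) auto
  fix S assume S: "S \<in> sets (Filt p (int l - 1))"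
  then have S' [measurable]: "S \<in> sets (Filt p (int l))"
    using subalgebra_Filt_mono[of "int l - 1" "int l"] by (auto simp: subalgebra_def)
  let ?K = "\<lambda>\<omega>. indicator S \<omega> * noise l \<omega>"
  have K_meas: "?K \<in> borel_measurable (Filt p (int l))"
    using measurable_noise[of l] by measurable
  have K: "?K \<in> L2 p"
    unfolding L2_def
  proof (intro CollectI conjI)
    show "?K \<in> borel_measurable M" by (rule measurable_Filt_imp[OF K_meas])
    show "integrable M (\<lambda>\<omega>. (?K \<omega>)\<^sup>2)"
      by (rule Bochner_Integration.integrable_bound[OF L2_square_integrable[OF noise_L2[of l]]])
        (use measurable_Filt_imp[OF K_meas] in \<open>auto simp: indicator_def\<close>)
  qed
  have inv: "indicator S (fun_upd \<omega> l x) = (indicator S \<omega> :: real)"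
    if "\<omega> \<in> space M" "x \<in> {-1, 1}" for \<omega> x
    using Filt_invariant_set[OF S, of l] that by (simp add: indicator_def)
  have s: "sqrt (p l * (1 - p l)) > 0" using p_bounds[of l] by simp
  have avg_K: "avg l ?K \<omega> = 0" if "\<omega> \<in> space M" for \<omega>
  proof -
    have "c * (i * ((1 - (2 * c - 1)) / (2 * r))) + (1 - c) * (i * ((-1 - (2 * c - 1)) / (2 * r))) = 0"
      if "r > 0" for r i c :: real
      using that by (simp add: field_simps)
    from this[OF s, of "p l" "indicator S \<omega>"] show ?thesis
      by (simp add: avg_def noise_def inv that)
  qed
  have Grad_K: "Grad p l ?K \<omega> = indicator S \<omega>" if "\<omega> \<in> space M" for \<omega>
  proof -
    have "r * (i * ((1 - c) / (2 * r)) - i * ((-1 - c) / (2 * r))) = i" if "r > 0" for r i c :: real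
      using that by (simp add: field_simps)
    from this[OF s, of "indicator S \<omega>" "2 * p l - 1"] show ?thesis
      by (simp add: Grad_def noise_def inv that)
  qed
  have *: "(\<integral>\<omega>. ?K \<omega> * F \<omega> \<partial>M) = (\<integral>\<omega>. indicator S \<omega> * Grad p l F \<omega> \<partial>M)"
    if F: "F \<in> L2 p" for F
  proof -
    have "(\<integral>\<omega>. ?K \<omega> * F \<omega> \<partial>M) = (\<integral>\<omega>. F \<omega> * avg l ?K \<omega> \<partial>M) + (\<integral>\<omega>. Grad p l F \<omega> * Grad p l ?K \<omega> \<partial>M)"
      using integral_mult_split[OF F K, of l] by (simp add: mult_ac)
    also have "(\<integral>\<omega>. F \<omega> * avg l ?K \<omega> \<partial>M) = (\<integral>\<omega>. 0 \<partial>M)"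
      by (rule Bochner_Integration.integral_cong) (auto simp: avg_K)
    also have "(\<integral>\<omega>. Grad p l F \<omega> * Grad p l ?K \<omega> \<partial>M) = (\<integral>\<omega>. indicator S \<omega> * Grad p l F \<omega> \<partial>M)"
      by (rule Bochner_Integration.integral_cong) (auto simp: Grad_K)
    finally show ?thesis by simp
  qed
  show "(\<integral>\<omega>. indicator S \<omega> * Grad p l B \<omega> \<partial>M) = (\<integral>\<omega>. indicator S \<omega> * Grad p l ?H \<omega> \<partial>M)"
    using integral_mult_cond[OF K K_meas B] *[OF B] *[OF H] by simp
qed

definition cov_term ::
  "nat \<Rightarrow> ((nat \<Rightarrow> real) \<Rightarrow> real) \<Rightarrow> ((nat \<Rightarrow> real) \<Rightarrow> real) \<Rightarrow> real" where
  "cov_term l A B = (\<integral>\<omega>. Grad p l A \<omega> * cond l (Grad p l B) \<omega> \<partial>M)"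

lemma integral_mult_cong_AE:
  fixes A F G :: "(nat \<Rightarrow> real) \<Rightarrow> real"
  assumes "AE \<omega> in M. F \<omega> = G \<omega>" "A \<in> L2 p" "F \<in> L2 p" "G \<in> L2 p"
  shows "(\<integral>\<omega>. A \<omega> * F \<omega> \<partial>M) = (\<integral>\<omega>. A \<omega> * G \<omega> \<partial>M)"
  using assms by (intro integral_cong_AE) (auto intro!: borel_measurable_times L2_measurable)

lemma cov_term_eq_diff:
  assumes A: "A \<in> L2 p" and B: "B \<in> L2 p"
  shows "cov_term l A B = (\<integral>\<omega>. A \<omega> * cond (Suc l) B \<omega> \<partial>M) - (\<integral>\<omega>. A \<omega> * cond l B \<omega> \<partial>M)"
proof -
  let ?H = "CondExpect p (int l) B"
  have H: "?H \<in> L2 p" using B by (rule L2_cond)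
  have "(\<integral>\<omega>. A \<omega> * ?H \<omega> \<partial>M) =
      (\<integral>\<omega>. A \<omega> * avg l ?H \<omega> \<partial>M) + (\<integral>\<omega>. Grad p l A \<omega> * Grad p l ?H \<omega> \<partial>M)"
    by (rule integral_mult_split[OF A H])
  also have "(\<integral>\<omega>. A \<omega> * avg l ?H \<omega> \<partial>M) = (\<integral>\<omega>. A \<omega> * cond l B \<omega> \<partial>M)"
    using integral_mult_cong_AE[OF avg_cond[OF B] A L2_cond[OF B] L2_avg[OF H]] by simp
  also have "(\<integral>\<omega>. Grad p l A \<omega> * Grad p l ?H \<omega> \<partial>M) = cov_term l A B"
    unfolding cov_term_def
    using integral_mult_cong_AE[OF Grad_cond[OF B] L2_Grad[OF A] L2_cond[OF L2_Grad[OF B]]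
      L2_Grad[OF H]] by simp
  finally show ?thesis by simp
qed

lemma cov_term_cond:
  assumes "A \<in> L2 p" "B \<in> L2 p"
  shows "cov_term l A B = (\<integral>\<omega>. cond l (Grad p l A) \<omega> * cond l (Grad p l B) \<omega> \<partial>M)"
  unfolding cov_term_def using assms by (intro integral_mult_cond' L2_Grad)

lemma abs_integral_mult_le:
  assumes A: "A \<in> L2 p" and B: "B \<in> L2 p"
  shows "2 * \<bar>\<integral>\<omega>. A \<omega> * B \<omega> \<partial>M\<bar> \<le> (\<integral>\<omega>. A \<omega> * A \<omega> \<partial>M) + (\<integral>\<omega>. B \<omega> * B \<omega> \<partial>M)"
proof -
  have "2 * \<bar>\<integral>\<omega>. A \<omega> * B \<omega> \<partial>M\<bar> \<le> 2 * (\<integral>\<omega>. \<bar>A \<omega> * B \<omega>\<bar> \<partial>M)"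
    using integral_abs_bound[of M "\<lambda>\<omega>. A \<omega> * B \<omega>"] by simp
  also have "\<dots> = (\<integral>\<omega>. 2 * \<bar>A \<omega> * B \<omega>\<bar> \<partial>M)" by simp
  also have "\<dots> \<le> (\<integral>\<omega>. A \<omega> * A \<omega> + B \<omega> * B \<omega> \<partial>M)"
  proof (rule integral_mono)
    fix \<omega>
    show "2 * \<bar>A \<omega> * B \<omega>\<bar> \<le> A \<omega> * A \<omega> + B \<omega> * B \<omega>"
      using sum_squares_bound[of "\<bar>A \<omega>\<bar>" "\<bar>B \<omega>\<bar>"] by (simp add: abs_mult power2_eq_square)
  qed (use A B L2_mult_integrable in auto)
  also have "\<dots> = (\<integral>\<omega>. A \<omega> * A \<omega> \<partial>M) + (\<integral>\<omega>. B \<omega> * B \<omega> \<partial>M)"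
    using A B by (intro Bochner_Integration.integral_add L2_mult_integrable)
  finally show ?thesis .
qed

lemma abs_cov_term_le:
  assumes "A \<in> L2 p" "B \<in> L2 p"
  shows "2 * \<bar>cov_term l A B\<bar> \<le> cov_term l A A + cov_term l B B"
  using assms abs_integral_mult_le[OF L2_cond[OF L2_Grad] L2_cond[OF L2_Grad]]
  by (simp add: cov_term_cond)

lemma cov_term_sums:
  assumes A: "A \<in> L2 p" and B: "B \<in> L2 p"
    and lim: "(\<lambda>N. \<integral>\<omega>. A \<omega> * cond N B \<omega> \<partial>M) \<longlonglongrightarrow> (\<integral>\<omega>. A \<omega> * B \<omega> \<partial>M)"
  shows "(\<lambda>l. cov_term (l + m) A B) sums ((\<integral>\<omega>. A \<omega> * B \<omega> \<partial>M) - (\<integral>\<omega>. A \<omega> * cond m B \<omega> \<partial>M))"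
proof -
  define e where "e N = (\<integral>\<omega>. A \<omega> * cond (N + m) B \<omega> \<partial>M)" for N
  have "e \<longlonglongrightarrow> (\<integral>\<omega>. A \<omega> * B \<omega> \<partial>M)"
    unfolding e_def using lim by (rule LIMSEQ_ignore_initial_segment)
  from telescope_sums[OF this]
  show ?thesis
    using cov_term_eq_diff[OF A B] by (simp add: e_def)
qed

section \<open>Convergence of the conditional expectations\<close>

lemma cond_diff:
  assumes "integrable M f" "integrable M g"
  shows "AE \<omega> in M. CondExpect p m (\<lambda>\<omega>. f \<omega> - g \<omega>) \<omega> = CondExpect p m f \<omega> - CondExpect p m g \<omega>"
  unfolding CondExpect_def
  using sigma_finite_subalgebra.real_cond_exp_diff[OF sigma_finite_subalgebra_Filt assms] .

lemma cond_add:
  assumes "integrable M f" "integrable M g"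
  shows "AE \<omega> in M. CondExpect p m (\<lambda>\<omega>. f \<omega> + g \<omega>) \<omega> = CondExpect p m f \<omega> + CondExpect p m g \<omega>"
  unfolding CondExpect_def
  using sigma_finite_subalgebra.real_cond_exp_add[OF sigma_finite_subalgebra_Filt assms] .

lemma cond_measurable_id:
  assumes "integrable M f" "f \<in> borel_measurable (Filt p m)"
  shows "AE \<omega> in M. CondExpect p m f \<omega> = f \<omega>"
  unfolding CondExpect_def
  using sigma_finite_subalgebra.real_cond_exp_F_meas[OF sigma_finite_subalgebra_Filt assms] .

lemma integrable_cond: "integrable M f \<Longrightarrow> integrable M (CondExpect p m f)"
  unfolding CondExpect_def
  by (rule sigma_finite_subalgebra.real_cond_exp_int(1)[OF sigma_finite_subalgebra_Filt])

lemma cond_L1_contraction: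
  assumes f: "integrable M f"
  shows "(\<integral>\<omega>. \<bar>CondExpect p m f \<omega>\<bar> \<partial>M) \<le> (\<integral>\<omega>. \<bar>f \<omega>\<bar> \<partial>M)"
proof -
  interpret sigma_finite_subalgebra M "Filt p m" by (rule sigma_finite_subalgebra_Filt)
  let ?C = "real_cond_exp M (Filt p m)"
  have "AE \<omega> in M. ?C f \<omega> \<le> ?C (\<lambda>\<omega>. \<bar>f \<omega>\<bar>) \<omega>"
    using f by (intro real_cond_exp_mono) auto
  moreover have "AE \<omega> in M. ?C (\<lambda>\<omega>. (-1) * f \<omega>) \<omega> \<le> ?C (\<lambda>\<omega>. \<bar>f \<omega>\<bar>) \<omega>"
    using f by (intro real_cond_exp_mono) auto
  moreover have "AE \<omega> in M. ?C (\<lambda>\<omega>. (-1) * f \<omega>) \<omega> = (-1) * ?C f \<omega>"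
    using f by (rule real_cond_exp_cmult)
  ultimately have "AE \<omega> in M. \<bar>?C f \<omega>\<bar> \<le> ?C (\<lambda>\<omega>. \<bar>f \<omega>\<bar>) \<omega>"
    by eventually_elim auto
  then have "(\<integral>\<omega>. \<bar>?C f \<omega>\<bar> \<partial>M) \<le> (\<integral>\<omega>. ?C (\<lambda>\<omega>. \<bar>f \<omega>\<bar>) \<omega> \<partial>M)"
    using f by (intro integral_mono_AE) (auto intro: real_cond_exp_int)
  also have "\<dots> = (\<integral>\<omega>. \<bar>f \<omega>\<bar> \<partial>M)"
    using f by (intro real_cond_exp_int) auto
  finally show ?thesis by (simp add: CondExpect_def)
qed

definition L1_error :: "nat \<Rightarrow> ((nat \<Rightarrow> real) \<Rightarrow> real) \<Rightarrow> real" where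
  "L1_error N f = (\<integral>\<omega>. \<bar>f \<omega> - cond N f \<omega>\<bar> \<partial>M)"

lemma L1_error_nonneg: "0 \<le> L1_error N f"
  unfolding L1_error_def by (rule integral_nonneg_AE) simp

lemma L1_error_add_le:
  assumes f: "integrable M f" and g: "integrable M g"
  shows "L1_error N (\<lambda>\<omega>. f \<omega> + g \<omega>) \<le> L1_error N f + L1_error N g"
proof -
  note c = f g integrable_cond[OF f, of "int N - 1"] integrable_cond[OF g, of "int N - 1"]
    integrable_cond[of "\<lambda>\<omega>. f \<omega> + g \<omega>" "int N - 1"]
  have "L1_error N (\<lambda>\<omega>. f \<omega> + g \<omega>) \<le> (\<integral>\<omega>. \<bar>f \<omega> - cond N f \<omega>\<bar> + \<bar>g \<omega> - cond N g \<omega>\<bar> \<partial>M)"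
    unfolding L1_error_def
  proof (rule integral_mono_AE)
    show "AE \<omega> in M. \<bar>f \<omega> + g \<omega> - cond N (\<lambda>\<omega>. f \<omega> + g \<omega>) \<omega>\<bar>
        \<le> \<bar>f \<omega> - cond N f \<omega>\<bar> + \<bar>g \<omega> - cond N g \<omega>\<bar>"
      using cond_add[OF f g, of "int N - 1"] by eventually_elim auto
  qed (use c in auto)
  also have "\<dots> = L1_error N f + L1_error N g"
    unfolding L1_error_def using c by (intro Bochner_Integration.integral_add) auto
  finally show ?thesis .
qed

lemma L1_error_le:
  assumes f: "integrable M f"
  shows "L1_error N f \<le> 2 * (\<integral>\<omega>. \<bar>f \<omega>\<bar> \<partial>M)"
proof -
  note c = f integrable_cond[OF f, of "int N - 1"]
  have "L1_error N f \<le> (\<integral>\<omega>. \<bar>f \<omega>\<bar> + \<bar>cond N f \<omega>\<bar> \<partial>M)"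
    unfolding L1_error_def using c by (intro integral_mono) auto
  also have "\<dots> = (\<integral>\<omega>. \<bar>f \<omega>\<bar> \<partial>M) + (\<integral>\<omega>. \<bar>cond N f \<omega>\<bar> \<partial>M)"
    using c by (intro Bochner_Integration.integral_add) auto
  finally show ?thesis
    using cond_L1_contraction[OF f, of "int N - 1"] by simp
qed

lemma L1_error_add_tendsto:
  assumes "integrable M f" "(\<lambda>N. L1_error N f) \<longlonglongrightarrow> 0"
    and "integrable M g" "(\<lambda>N. L1_error N g) \<longlonglongrightarrow> 0"
  shows "(\<lambda>N. L1_error N (\<lambda>\<omega>. f \<omega> + g \<omega>)) \<longlonglongrightarrow> 0"
proof (rule tendsto_sandwich[OF _ _ tendsto_const])
  show "(\<lambda>N. L1_error N f + L1_error N g) \<longlonglongrightarrow> 0"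
    using tendsto_add[OF assms(2,4)] by simp
qed (use assms L1_error_add_le L1_error_nonneg in auto)

lemma L1_error_limit:
  assumes f: "integrable M f" and s: "\<And>i. integrable M (s i)"
    and s0: "\<And>i. (\<lambda>N. L1_error N (s i)) \<longlonglongrightarrow> 0"
    and lim: "\<And>\<omega>. \<omega> \<in> space M \<Longrightarrow> (\<lambda>i. s i \<omega>) \<longlonglongrightarrow> f \<omega>"
    and bound: "\<And>i \<omega>. \<omega> \<in> space M \<Longrightarrow> \<bar>s i \<omega>\<bar> \<le> 2 * \<bar>f \<omega>\<bar>"
  shows "(\<lambda>N. L1_error N f) \<longlonglongrightarrow> 0"
proof (rule LIMSEQ_I)
  fix e :: real assume e: "e > 0"
  have "(\<lambda>i. \<integral>\<omega>. \<bar>f \<omega> - s i \<omega>\<bar> \<partial>M) \<longlonglongrightarrow> (\<integral>\<omega>. 0 \<partial>M)"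
  proof (rule integral_dominated_convergence[where w = "\<lambda>\<omega>. 3 * \<bar>f \<omega>\<bar>"])
    show "AE \<omega> in M. (\<lambda>i. \<bar>f \<omega> - s i \<omega>\<bar>) \<longlonglongrightarrow> 0"
    proof (rule AE_I2)
      fix \<omega> assume "\<omega> \<in> space M"
      from tendsto_rabs[OF tendsto_diff[OF tendsto_const[of "f \<omega>"] lim[OF this]]]
      show "(\<lambda>i. \<bar>f \<omega> - s i \<omega>\<bar>) \<longlonglongrightarrow> 0" by simp
    qed
    show "AE \<omega> in M. norm \<bar>f \<omega> - s i \<omega>\<bar> \<le> 3 * \<bar>f \<omega>\<bar>" for i
    proof (rule AE_I2)
      fix \<omega> assume "\<omega> \<in> space M"
      from bound[OF this, of i] show "norm \<bar>f \<omega> - s i \<omega>\<bar> \<le> 3 * \<bar>f \<omega>\<bar>" by auto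
    qed
  qed (use f s in auto)
  from LIMSEQ_D[OF this, of "e / 4"] e
  obtain i where i: "(\<integral>\<omega>. \<bar>f \<omega> - s i \<omega>\<bar> \<partial>M) < e / 4" by fastforce
  from LIMSEQ_D[OF s0[of i], of "e / 2"] e
  obtain N0 where N0: "\<And>N. N \<ge> N0 \<Longrightarrow> L1_error N (s i) < e / 2" by fastforce
  have "L1_error N f < e" if "N \<ge> N0" for N
    using L1_error_add_le[OF s[of i] Bochner_Integration.integrable_diff[OF f s[of i]], of N]
      L1_error_le[OF Bochner_Integration.integrable_diff[OF f s[of i]], of N] i N0[OF that] by simp
  then show "\<exists>no. \<forall>n\<ge>no. norm (L1_error n f - 0) < e"
    using L1_error_nonneg by (auto intro!: exI[of _ N0])
qed

lemma L1_error_measurable: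
  assumes "integrable M f" "f \<in> borel_measurable (Filt p m)"
  shows "(\<lambda>N. L1_error N f) \<longlonglongrightarrow> 0"
proof (rule tendsto_eventually)
  have "L1_error N f = 0" if "N \<ge> nat (m + 1)" for N
  proof -
    have "f \<in> borel_measurable (Filt p (int N - 1))"
      using that by (intro measurable_from_subalg[OF subalgebra_Filt_mono assms(2)]) linarith
    from cond_measurable_id[OF assms(1) this]
    have "AE \<omega> in M. \<bar>f \<omega> - cond N f \<omega>\<bar> = 0" by eventually_elim simp
    then have "L1_error N f = (\<integral>\<omega>. 0 \<partial>M)"
      unfolding L1_error_def
      using assms(1) integrable_cond[OF assms(1), of "int N - 1"] by (intro integral_cong_AE) auto
    then show ?thesis by simp
  qed
  then show "\<forall>\<^sub>F N in sequentially. L1_error N f = 0"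
    by (auto simp: eventually_sequentially)
qed

lemma integrable_indicator_M: "S \<in> sets M \<Longrightarrow> integrable M (indicator S :: _ \<Rightarrow> real)"
  by (simp add: less_top[symmetric])

lemma L1_error_indicator:
  assumes "S \<in> sets M"
  shows "(\<lambda>N. L1_error N (indicator S)) \<longlonglongrightarrow> 0"
proof -
  let ?P = "prod_algebra UNIV (\<lambda>k. bernoulli_pm (p k))"
  have M_eq: "sets M = sigma_sets (space M) ?P"
    unfolding Omega_def sets_PiM space_PiM ..
  have sub: "?P \<subseteq> Pow (space M)"
    unfolding Omega_def space_PiM by (rule prod_algebra_sets_into_space)
  have meas: "S \<in> sets M" if "S \<in> sigma_sets (space M) ?P" for S
    using that M_eq by simp
  show ?thesis
    using Int_stable_prod_algebra sub assms[unfolded M_eq]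
  proof (induction rule: sigma_sets_induct_disjoint)
    case (basic A)
    from prod_algebraE[OF basic(1)] obtain J E where J: "finite J"
      and A: "A = prod_emb UNIV (\<lambda>k. bernoulli_pm (p k)) J (Pi\<^sub>E J E)"
      and E: "\<And>i. i \<in> J \<Longrightarrow> E i \<in> sets (bernoulli_pm (p i))" by metis
    define m where "m = int (Max (insert 0 J))"
    have "A = space M \<inter> (\<Inter>j\<in>J. {\<omega> \<in> space M. \<omega> j \<in> E j})"
      unfolding A Omega_def by (auto simp: prod_emb_def space_PiM PiE_iff Pi_iff)
    moreover have "{\<omega> \<in> space M. \<omega> j \<in> E j} \<in> sets (Filt p m)" if "j \<in> J" for j
      using E[OF that] J that
      by (intro coordinate_in_Filt) (auto simp: m_def bernoulli_pm_def sets_point_measure)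
    moreover have "space M \<in> sets (Filt p m)"
      using sets.top[of "Filt p m"] by (simp add: space_Filt)
    ultimately have "A \<in> sets (Filt p m)"
      using J by (cases "J = {}") auto
    moreover have "A \<in> sets M" using basic by (intro meas) auto
    ultimately show ?case
      by (intro L1_error_measurable[of _ m] integrable_indicator_M) auto
  next
    case empty
    show ?case by (rule L1_error_measurable[of _ 0]) auto
  next
    case (compl A)
    note A = integrable_indicator_M[OF meas[OF compl(1)]]
    have 1: "(\<lambda>N. L1_error N (\<lambda>_. 1)) \<longlonglongrightarrow> 0" by (rule L1_error_measurable[of _ 0]) auto
    have "L1_error N (indicator (space M - A)) = L1_error N (indicator A)" for N
    proof -
      have eq: "indicator (space M - A) \<omega> = 1 - (indicator A \<omega> :: real)" if "\<omega> \<in> space M" for \<omega>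
        using that by (auto simp: indicator_def)
      have "AE \<omega> in M. cond N (indicator (space M - A)) \<omega> = cond N (\<lambda>\<omega>. 1 - indicator A \<omega>) \<omega>"
        unfolding CondExpect_def
        by (rule sigma_finite_subalgebra.real_cond_exp_cong[OF sigma_finite_subalgebra_Filt])
          (use eq meas[OF compl(1)] in auto)
      moreover have "AE \<omega> in M. cond N (\<lambda>\<omega>. 1 - indicator A \<omega>) \<omega> = cond N (\<lambda>_. 1) \<omega> - cond N (indicator A) \<omega>"
        by (rule cond_diff[OF _ A]) simp
      moreover have "AE \<omega> in M. cond N (\<lambda>_. 1) \<omega> = 1"
        by (rule cond_measurable_id) auto
      ultimately have "AE \<omega> in M. \<bar>indicator (space M - A) \<omega> - cond N (indicator (space M - A)) \<omega>\<bar> =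
          \<bar>indicator A \<omega> - cond N (indicator A) \<omega>\<bar>"
        using AE_space by eventually_elim (simp add: eq abs_minus_commute)
      then show ?thesis
        unfolding L1_error_def
        using meas[OF compl(1)] borel_measurable_cond(2) by (intro integral_cong_AE) auto
    qed
    then show ?case using compl.IH by simp
  next
    case (union A)
    have A: "A i \<in> sets M" for i using union(2) by (auto intro: meas)
    let ?s = "\<lambda>i \<omega>. indicator (\<Union>j<i. A j) \<omega> :: real"
    have s: "integrable M (?s i)" for i
      using A by (intro integrable_indicator_M) auto
    show ?case
    proof (rule L1_error_limit[where s = ?s])
      show "integrable M (indicator (\<Union> (range A)) :: _ \<Rightarrow> real)"
        using A by (intro integrable_indicator_M) auto
      show "(\<lambda>N. L1_error N (?s i)) \<longlonglongrightarrow> 0" for i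
      proof (induction i)
        case 0
        show ?case by (simp, rule L1_error_measurable[of _ 0]) auto
      next
        case (Suc i)
        have "A j \<inter> A i = {}" if "j < i" for j
          using union(1) that by (simp add: disjoint_family_on_def)
        then have "(\<Union>j<i. A j) \<inter> A i = {}" by blast
        moreover have "(\<Union>j<Suc i. A j) = (\<Union>j<i. A j) \<union> A i"
          by (auto simp: lessThan_Suc)
        ultimately have eq: "?s (Suc i) = (\<lambda>\<omega>. ?s i \<omega> + indicator (A i) \<omega>)"
          by (simp add: indicator_disj_union fun_eq_iff)
        show ?case
          unfolding eq by (rule L1_error_add_tendsto[OF s Suc.IH integrable_indicator_M[OF A] union.IH])
      qed
      show "(\<lambda>i. ?s i \<omega>) \<longlonglongrightarrow> indicator (\<Union> (range A)) \<omega>" for \<omega>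
        by (rule LIMSEQ_indicator_UN)
      show "\<bar>?s i \<omega>\<bar> \<le> 2 * \<bar>indicator (\<Union> (range A)) \<omega>\<bar>" for i \<omega>
        by (auto simp: indicator_def)
    qed (rule s)
  qed
qed

lemma L1_error_tendsto_0:
  assumes "integrable M f"
  shows "(\<lambda>N. L1_error N f) \<longlonglongrightarrow> 0"
  using assms
proof (induction rule: integrable_induct)
  case (base A c)
  have i: "integrable M (indicator A :: _ \<Rightarrow> real)" using base by (intro integrable_indicator_M)
  have "L1_error N (\<lambda>\<omega>. indicator A \<omega> *\<^sub>R c) = \<bar>c\<bar> * L1_error N (indicator A)" for N
  proof -
    have "AE \<omega> in M. cond N (\<lambda>\<omega>. c * indicator A \<omega>) \<omega> = c * cond N (indicator A) \<omega>"
      unfolding CondExpect_def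
      by (rule sigma_finite_subalgebra.real_cond_exp_cmult[OF sigma_finite_subalgebra_Filt i])
    then have "AE \<omega> in M. \<bar>c * indicator A \<omega> - cond N (\<lambda>\<omega>. c * indicator A \<omega>) \<omega>\<bar> =
        \<bar>c\<bar> * \<bar>indicator A \<omega> - cond N (indicator A) \<omega>\<bar>"
      by eventually_elim (simp add: abs_mult flip: right_diff_distrib)
    then have "L1_error N (\<lambda>\<omega>. c * indicator A \<omega>) =
        (\<integral>\<omega>. \<bar>c\<bar> * \<bar>indicator A \<omega> - cond N (indicator A) \<omega>\<bar> \<partial>M)"
      unfolding L1_error_def using base(1) borel_measurable_cond(2)
      by (intro integral_cong_AE) auto
    then show ?thesis by (simp add: L1_error_def mult.commute)
  qed
  then show ?case
    using tendsto_mult_right_zero[OF L1_error_indicator[OF base(1)], of "\<bar>c\<bar>"] by simp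
next
  case (add f g)
  then show ?case by (intro L1_error_add_tendsto)
next
  case (lim f s)
  then show ?case by (intro L1_error_limit[of f s]) auto
qed

lemma integral_square_cond_le:
  assumes A: "A \<in> L2 p"
  shows "(\<integral>\<omega>. (CondExpect p m A \<omega>)\<^sup>2 \<partial>M) \<le> (\<integral>\<omega>. (A \<omega>)\<^sup>2 \<partial>M)"
  using abs_integral_mult_le[OF A L2_cond[OF A], of m] integral_mult_cond'[OF A A, of m]
  by (simp add: power2_eq_square)

lemma integral_square_diff_cond_le:
  assumes A: "A \<in> L2 p"
  shows "(\<integral>\<omega>. (A \<omega> - CondExpect p m A \<omega>)\<^sup>2 \<partial>M) \<le> 4 * (\<integral>\<omega>. (A \<omega>)\<^sup>2 \<partial>M)"
proof -
  note i = L2_square_integrable[OF A] L2_square_integrable[OF L2_cond[OF A, of m]]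
  have "(\<integral>\<omega>. (A \<omega> - CondExpect p m A \<omega>)\<^sup>2 \<partial>M) \<le>
      (\<integral>\<omega>. 2 * (A \<omega>)\<^sup>2 + 2 * (CondExpect p m A \<omega>)\<^sup>2 \<partial>M)"
  proof (rule integral_mono)
    show "integrable M (\<lambda>\<omega>. (A \<omega> - CondExpect p m A \<omega>)\<^sup>2)"
      by (rule L2_square_integrable[OF L2_diff[OF A L2_cond[OF A]]])
    fix \<omega>
    show "(A \<omega> - CondExpect p m A \<omega>)\<^sup>2 \<le> 2 * (A \<omega>)\<^sup>2 + 2 * (CondExpect p m A \<omega>)\<^sup>2"
      using zero_le_power2[of "A \<omega> + CondExpect p m A \<omega>"]
      by (simp add: power2_sum power2_diff)
  qed (use i in simp)
  also have "\<dots> = 2 * (\<integral>\<omega>. (A \<omega>)\<^sup>2 \<partial>M) + 2 * (\<integral>\<omega>. (CondExpect p m A \<omega>)\<^sup>2 \<partial>M)"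
    using i by simp
  finally show ?thesis
    using integral_square_cond_le[OF A, of m] by simp
qed

lemma L2_bounded_approx:
  assumes B: "B \<in> L2 p" and e: "e > 0"
  obtains K B' where "K \<ge> 0" "B' \<in> borel_measurable M" "\<And>\<omega>. \<bar>B' \<omega>\<bar> \<le> K"
    "(\<integral>\<omega>. (B \<omega> - B' \<omega>)\<^sup>2 \<partial>M) < e"
proof -
  define T where "T i \<omega> = max (- real i) (min (real i) (B \<omega>))" for i :: nat and \<omega>
  have T [measurable]: "T i \<in> borel_measurable M" for i
    unfolding T_def using L2_measurable[OF B] by measurable
  have "(\<lambda>i. \<integral>\<omega>. (B \<omega> - T i \<omega>)\<^sup>2 \<partial>M) \<longlonglongrightarrow> (\<integral>\<omega>. 0 \<partial>M)"
  proof (rule integral_dominated_convergence[where w = "\<lambda>\<omega>. (B \<omega>)\<^sup>2"])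
    show "AE \<omega> in M. (\<lambda>i. (B \<omega> - T i \<omega>)\<^sup>2) \<longlonglongrightarrow> 0"
    proof (rule AE_I2, rule tendsto_eventually)
      fix \<omega>
      obtain k :: nat where "\<bar>B \<omega>\<bar> \<le> real k" using real_arch_simple by blast
      then have "(B \<omega> - T i \<omega>)\<^sup>2 = 0" if "i \<ge> k" for i
        using that by (simp add: T_def)
      then show "\<forall>\<^sub>F i in sequentially. (B \<omega> - T i \<omega>)\<^sup>2 = 0"
        by (auto simp: eventually_sequentially)
    qed
    show "AE \<omega> in M. norm ((B \<omega> - T i \<omega>)\<^sup>2) \<le> (B \<omega>)\<^sup>2" for i
    proof (rule AE_I2)
      fix \<omega>
      have "\<bar>B \<omega> - T i \<omega>\<bar> \<le> \<bar>B \<omega>\<bar>" by (auto simp: T_def)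
      then show "norm ((B \<omega> - T i \<omega>)\<^sup>2) \<le> (B \<omega>)\<^sup>2"
        by (simp add: abs_le_square_iff)
    qed
  qed (use L2_measurable[OF B] L2_square_integrable[OF B] in auto)
  from LIMSEQ_D[OF this e] obtain i where "(\<integral>\<omega>. (B \<omega> - T i \<omega>)\<^sup>2 \<partial>M) < e" by fastforce
  moreover have "\<bar>T i \<omega>\<bar> \<le> real i" for \<omega> by (auto simp: T_def)
  ultimately show thesis using T[of i] that[of "real i" "T i"] by simp
qed

lemma integral_mult_cond_tendsto:
  assumes A: "A \<in> L2 p" and B: "B \<in> L2 p"
  shows "(\<lambda>N. \<integral>\<omega>. A \<omega> * cond N B \<omega> \<partial>M) \<longlonglongrightarrow> (\<integral>\<omega>. A \<omega> * B \<omega> \<partial>M)"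
proof (rule LIMSEQ_I)
  fix e :: real assume e: "e > 0"
  define s where "s = 4 * (\<integral>\<omega>. (A \<omega>)\<^sup>2 \<partial>M) + 1"
  have s: "s > 0" by (simp add: s_def add_nonneg_pos)
  define d where "d = e / (4 * s)"
  have d: "d > 0" using e s by (simp add: d_def)
  obtain K B' where K: "K \<ge> 0" and B'_meas [measurable]: "B' \<in> borel_measurable M"
    and B'_le: "\<And>\<omega>. \<bar>B' \<omega>\<bar> \<le> K" and B'_close: "(\<integral>\<omega>. (B \<omega> - B' \<omega>)\<^sup>2 \<partial>M) < e * d / 4"
    using L2_bounded_approx[OF B, of "e * d / 4"] e d by auto
  have B': "B' \<in> L2 p" by (rule L2_bounded[OF B'_meas B'_le])
  from LIMSEQ_D[OF L1_error_tendsto_0[OF L2_integrable[OF A]], of "e / (4 * (K + 1))"] e K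
  obtain N0 where N0: "\<And>N. N \<ge> N0 \<Longrightarrow> L1_error N A < e / (4 * (K + 1))" by fastforce
  have "\<bar>(\<integral>\<omega>. A \<omega> * cond N B \<omega> \<partial>M) - (\<integral>\<omega>. A \<omega> * B \<omega> \<partial>M)\<bar> < e" if N: "N \<ge> N0" for N
  proof -
    let ?D = "\<lambda>\<omega>. A \<omega> - cond N A \<omega>"
    have D: "?D \<in> L2 p" using A by (intro L2_diff L2_cond)
    have BB: "(\<lambda>\<omega>. B \<omega> - B' \<omega>) \<in> L2 p" using B B' by (rule L2_diff)
    have "(\<integral>\<omega>. A \<omega> * cond N B \<omega> \<partial>M) = (\<integral>\<omega>. cond N A \<omega> * B \<omega> \<partial>M)"
      using integral_mult_cond'[OF A B, of "int N - 1"] integral_mult_cond'[OF B A, of "int N - 1"]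
      by (simp add: mult.commute)
    then have "\<bar>(\<integral>\<omega>. A \<omega> * cond N B \<omega> \<partial>M) - (\<integral>\<omega>. A \<omega> * B \<omega> \<partial>M)\<bar> = \<bar>\<integral>\<omega>. ?D \<omega> * B \<omega> \<partial>M\<bar>"
      using L2_mult_integrable[OF A B] L2_mult_integrable[OF L2_cond[OF A] B]
      by (simp add: left_diff_distrib abs_minus_commute)
    also have "\<dots> \<le> (\<integral>\<omega>. \<bar>?D \<omega> * B \<omega>\<bar> \<partial>M)"
      by (rule integral_abs_bound)
    also have "\<dots> \<le> (\<integral>\<omega>. K * \<bar>?D \<omega>\<bar> + (d * (?D \<omega>)\<^sup>2 + (B \<omega> - B' \<omega>)\<^sup>2 / d) \<partial>M)"
    proof (rule integral_mono)
      fix \<omega>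
      have "\<bar>?D \<omega> * B \<omega>\<bar> \<le> \<bar>?D \<omega> * B' \<omega>\<bar> + \<bar>?D \<omega> * (B \<omega> - B' \<omega>)\<bar>"
        using abs_triangle_ineq[of "?D \<omega> * B' \<omega>" "?D \<omega> * (B \<omega> - B' \<omega>)"]
        by (simp add: algebra_simps)
      moreover have "\<bar>?D \<omega> * B' \<omega>\<bar> \<le> K * \<bar>?D \<omega>\<bar>"
        using mult_left_mono[OF B'_le[of \<omega>], of "\<bar>?D \<omega>\<bar>"] by (simp add: abs_mult mult.commute)
      moreover note abs_mult_le_weighted[OF d, of "?D \<omega>" "B \<omega> - B' \<omega>"]
      ultimately show "\<bar>?D \<omega> * B \<omega>\<bar> \<le> K * \<bar>?D \<omega>\<bar> + (d * (?D \<omega>)\<^sup>2 + (B \<omega> - B' \<omega>)\<^sup>2 / d)"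
        by linarith
    qed (use L2_mult_integrable[OF D B] L2_integrable[OF D] L2_square_integrable[OF D]
        L2_square_integrable[OF BB] in auto)
    also have "\<dots> = K * L1_error N A + d * (\<integral>\<omega>. (?D \<omega>)\<^sup>2 \<partial>M) + (\<integral>\<omega>. (B \<omega> - B' \<omega>)\<^sup>2 \<partial>M) / d"
      unfolding L1_error_def
      using L2_integrable[OF D] L2_square_integrable[OF D] L2_square_integrable[OF BB] by simp
    also have "\<dots> < e"
    proof -
      have "L1_error N A * (K + 1) < e / 4"
        using N0[OF N] K by (simp add: field_simps)
      then have "K * L1_error N A < e / 4"
        using L1_error_nonneg[of N A] by (simp add: algebra_simps)
      moreover have "d * (\<integral>\<omega>. (?D \<omega>)\<^sup>2 \<partial>M) \<le> d * s"
        using integral_square_diff_cond_le[OF A, of "int N - 1"] d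
        by (intro mult_left_mono) (auto simp: s_def)
      moreover have "d * s = e / 4" using s by (simp add: d_def)
      moreover have "(\<integral>\<omega>. (B \<omega> - B' \<omega>)\<^sup>2 \<partial>M) / d < e / 4"
        using B'_close d by (simp add: field_simps)
      ultimately show ?thesis using e by linarith
    qed
    finally show ?thesis .
  qed
  then show "\<exists>no. \<forall>N\<ge>no. norm ((\<integral>\<omega>. A \<omega> * cond N B \<omega> \<partial>M) - (\<integral>\<omega>. A \<omega> * B \<omega> \<partial>M)) < e"
    by auto
qed

lemma cov_term_has_sum:
  assumes A: "A \<in> L2 p" and B: "B \<in> L2 p"
  shows "((\<lambda>l. cov_term l A B) has_sum ((\<integral>\<omega>. A \<omega> * B \<omega> \<partial>M) - (\<integral>\<omega>. A \<omega> * cond m B \<omega> \<partial>M))) {m..}"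
proof -
  have sums: "(\<lambda>l. cov_term (l + m) F G) sums ((\<integral>\<omega>. F \<omega> * G \<omega> \<partial>M) - (\<integral>\<omega>. F \<omega> * cond m G \<omega> \<partial>M))"
    if "F \<in> L2 p" "G \<in> L2 p" for F G
    using that by (intro cov_term_sums integral_mult_cond_tendsto)
  have "summable (\<lambda>l. (cov_term (l + m) A A + cov_term (l + m) B B) / 2)"
    using sums[OF A A] sums[OF B B] by (intro summable_divide summable_add) (auto simp: sums_iff)
  then have "summable (\<lambda>l. norm (cov_term (l + m) A B))"
    by (rule summable_comparison_test')
      (use abs_cov_term_le[OF A B] in \<open>simp add: field_simps\<close>)
  from norm_summable_imp_has_sum[OF this sums[OF A B]]
  have "((\<lambda>l. cov_term (l + m) A B) has_sum ((\<integral>\<omega>. A \<omega> * B \<omega> \<partial>M) - (\<integral>\<omega>. A \<omega> * cond m B \<omega> \<partial>M))) UNIV" .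
  moreover have "bij_betw (\<lambda>l. l + m) UNIV {m..}"
    by (rule bij_betwI[where g = "\<lambda>l. l - m"]) auto
  ultimately show ?thesis
    using has_sum_reindex_bij_betw[of "\<lambda>l. l + m" UNIV "{m..}" "\<lambda>l. cov_term l A B"] by simp
qed

section \<open>The covariance expansion\<close>

abbreviation grad_prod where
  "grad_prod F G ks \<equiv> Expect p (\<lambda>\<omega>. Grads p ks F \<omega> * Grads p ks G \<omega>)"

abbreviation grad_cond_prod where
  "grad_cond_prod F G ks \<equiv>
    Expect p (\<lambda>\<omega>. Grads p ks F \<omega> * CondExpect p (int (last ks) - 1) (Grads p ks G) \<omega>)"

lemma grad_cond_prod_snoc:
  "grad_cond_prod F G (ks @ [l]) = cov_term l (Grads p ks F) (Grads p ks G)"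
  by (simp add: Grads_snoc cov_term_def Expect_def)

lemma integral_mult_cond_0:
  assumes F: "F \<in> L2 p" and G: "G \<in> L2 p"
  shows "(\<integral>\<omega>. F \<omega> * cond 0 G \<omega> \<partial>M) = Expect p F * Expect p G"
proof -
  have "sets (Filt p (int 0 - 1)) = {{}, space M}"
    unfolding sets_Filt by (simp add: sigma_sets_empty_eq)
  then have "AE \<omega> in M. cond 0 G \<omega> = Expect p G"
    by (intro cond_charact G L2_const)
      (auto simp: Expect_def prob_space intro!: Bochner_Integration.integral_cong)
  from integral_mult_cong_AE[OF this F L2_cond[OF G] L2_const]
  show ?thesis by (simp add: Expect_def)
qed

lemma grad_cond_prod_has_sum_Cov:
  assumes F: "F \<in> L2 p" and G: "G \<in> L2 p"
  shows "(grad_cond_prod F G has_sum Cov p F G) (tuples (Suc 0))"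
proof -
  have "((\<lambda>l. cov_term l F G) has_sum Cov p F G) UNIV"
    using cov_term_has_sum[OF F G, of 0] integral_mult_cond_0[OF F G]
    by (simp add: Cov_def Expect_def atLeast_0)
  moreover have "cov_term l F G = grad_cond_prod F G [l]" for l
    by (simp add: cov_term_def Expect_def Grads_def)
  ultimately show ?thesis
    using has_sum_reindex_bij_betw[OF bij_betw_tuples_1, of "grad_cond_prod F G"] by simp
qed

lemma grad_cond_prod_snoc_has_sum:
  assumes F: "F \<in> L2 p" and G: "G \<in> L2 p" and ks: "ks \<noteq> []"
  shows "((\<lambda>l. grad_cond_prod F G (ks @ [l])) has_sum (grad_prod F G ks - grad_cond_prod F G ks))
    {Suc (last ks)..}"
proof -
  let ?A = "Grads p ks F" and ?B = "Grads p ks G"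
  have A: "?A \<in> L2 p" and B: "?B \<in> L2 p" using F G by (auto intro: L2_Grads)
  have "cov_term (last ks) ?A ?B = 0"
    by (simp add: cov_term_def Grad_last_Grads[OF ks])
  then have "(\<integral>\<omega>. ?A \<omega> * cond (Suc (last ks)) ?B \<omega> \<partial>M) = (\<integral>\<omega>. ?A \<omega> * cond (last ks) ?B \<omega> \<partial>M)"
    using cov_term_eq_diff[OF A B, of "last ks"] by simp
  then show ?thesis
    unfolding grad_cond_prod_snoc
    using cov_term_has_sum[OF A B, of "Suc (last ks)"] by (simp add: Expect_def)
qed

lemma grad_cond_prod_step:
  assumes F: "F \<in> L2 p" and G: "G \<in> L2 p"
    and S: "grad_prod F G summable_on tuples (Suc d)"
    and T: "grad_cond_prod F G summable_on tuples (Suc (Suc d))"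
  shows "grad_cond_prod F G summable_on tuples (Suc d)"
    and "infsum (grad_cond_prod F G) (tuples (Suc d)) =
      infsum (grad_prod F G) (tuples (Suc d)) - infsum (grad_cond_prod F G) (tuples (Suc (Suc d)))"
proof -
  let ?f = "\<lambda>ks l. grad_cond_prod F G (ks @ [l])"
  let ?X = "SIGMA ks:tuples (Suc d). {Suc (last ks)..}"
  let ?r = "\<lambda>ks. grad_prod F G ks - grad_cond_prod F G ks"
  have f: "(\<lambda>(ks, l). ?f ks l) summable_on ?X"
    and f': "infsum (\<lambda>(ks, l). ?f ks l) ?X = infsum (grad_cond_prod F G) (tuples (Suc (Suc d)))"
    using T summable_on_reindex_bij_betw[OF bij_betw_tuples_Suc[of d], of "grad_cond_prod F G"]
      infsum_reindex_bij_betw[OF bij_betw_tuples_Suc[of d], of "grad_cond_prod F G"]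
    by (simp_all add: case_prod_unfold)
  have r: "infsum (?f ks) {Suc (last ks)..} = ?r ks" if "ks \<in> tuples (Suc d)" for ks
    by (rule infsumI[OF grad_cond_prod_snoc_has_sum[OF F G tuples_not_Nil[OF that]]])
  have R: "?r summable_on tuples (Suc d)"
    using summable_on_Sigma_banach[OF f] r by (simp cong: summable_on_cong)
  have R': "infsum ?r (tuples (Suc d)) = infsum (grad_cond_prod F G) (tuples (Suc (Suc d)))"
    using infsum_Sigma'_banach[OF f] r f' by (simp cong: infsum_cong)
  show T': "grad_cond_prod F G summable_on tuples (Suc d)"
    using summable_on_add[OF S summable_on_uminus[THEN iffD2, OF R]] by simp
  show "infsum (grad_cond_prod F G) (tuples (Suc d)) =
      infsum (grad_prod F G) (tuples (Suc d)) - infsum (grad_cond_prod F G) (tuples (Suc (Suc d)))"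
    using infsum_add[OF T' R] R' by simp
qed

lemma Cov_expansion:
  assumes F: "F \<in> L2 p" and G: "G \<in> L2 p"
    and "\<And>d. d \<in> {1..n} \<Longrightarrow> grad_prod F G summable_on tuples d"
    and "grad_cond_prod F G summable_on tuples (Suc n)"
  shows "Cov p F G = (\<Sum>d=1..n. (-1) ^ (d + 1) * infsum (grad_prod F G) (tuples d)) +
    (-1) ^ n * infsum (grad_cond_prod F G) (tuples (Suc n))"
  using assms(3,4)
proof (induction n)
  case 0
  show ?case using infsumI[OF grad_cond_prod_has_sum_Cov[OF F G]] by simp
next
  case (Suc n)
  note step = grad_cond_prod_step[OF F G Suc.prems(1)[of "Suc n"] Suc.prems(2)]
  have "Cov p F G = (\<Sum>d=1..n. (-1) ^ (d + 1) * infsum (grad_prod F G) (tuples d)) +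
      (-1) ^ n * infsum (grad_cond_prod F G) (tuples (Suc n))"
    using Suc.prems step(1) by (intro Suc.IH) auto
  then show ?case
    using step(2) by (simp add: algebra_simps)
qed

lemma Expect_infsum:
  assumes "\<And>ks. f ks \<in> L2 p" "\<And>ks. g ks \<in> L2 p"
    and "(\<lambda>ks. Expect p (\<lambda>\<omega>. \<bar>f ks \<omega> * g ks \<omega>\<bar>)) summable_on tuples d"
  shows "(\<lambda>ks. Expect p (\<lambda>\<omega>. f ks \<omega> * g ks \<omega>)) summable_on tuples d"
    and "Expect p (\<lambda>\<omega>. \<Sum>\<^sub>\<infinity>ks\<in>tuples d. f ks \<omega> * g ks \<omega>) =
      (\<Sum>\<^sub>\<infinity>ks\<in>tuples d. Expect p (\<lambda>\<omega>. f ks \<omega> * g ks \<omega>))"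
proof -
  have "(\<lambda>ks. norm (Expect p (\<lambda>\<omega>. f ks \<omega> * g ks \<omega>))) summable_on tuples d"
    by (rule Infinite_Sum.abs_summable_on_comparison_test'[OF assms(3)])
      (simp add: Expect_def integral_abs_bound)
  then show "(\<lambda>ks. Expect p (\<lambda>\<omega>. f ks \<omega> * g ks \<omega>)) summable_on tuples d"
    by (rule summable_on_iff_abs_summable_on_real[THEN iffD2])
  show "Expect p (\<lambda>\<omega>. \<Sum>\<^sub>\<infinity>ks\<in>tuples d. f ks \<omega> * g ks \<omega>) =
      (\<Sum>\<^sub>\<infinity>ks\<in>tuples d. Expect p (\<lambda>\<omega>. f ks \<omega> * g ks \<omega>))"
    using assms unfolding Expect_def by (intro integral_infsum L2_mult_integrable) auto
qed

end

theorem theorem11p6: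
  fixes p :: "nat \<Rightarrow> real" and n :: nat and F G :: "(nat \<Rightarrow> real) \<Rightarrow> real"
  assumes "\<And>k. 0 < p k \<and> p k < 1"
    and "F \<in> L2 p" and "G \<in> L2 p"
  shows
    \<comment> \<open>expectations of the (absolutely convergent in mean) series over tuples\<close>
    "((\<forall>d\<in>{1..n}. (\<lambda>ks. Expect p (\<lambda>\<omega>. \<bar>Grads p ks F \<omega> * Grads p ks G \<omega>\<bar>)) summable_on tuples d) \<and>
      (\<lambda>ks. Expect p (\<lambda>\<omega>. \<bar>Grads p ks F \<omega> * CondExpect p (int (last ks) - 1) (Grads p ks G) \<omega>\<bar>))
        summable_on tuples (n + 1)
      \<longrightarrow>
      Cov p F G =
        (\<Sum>d=1..n. (-1) ^ (d + 1) *
           Expect p (\<lambda>\<omega>. \<Sum>\<^sub>\<infinity>ks\<in>tuples d. Grads p ks F \<omega> * Grads p ks G \<omega>))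
        + (-1) ^ n *
           Expect p (\<lambda>\<omega>. \<Sum>\<^sub>\<infinity>ks\<in>tuples (n + 1).
             Grads p ks F \<omega> * CondExpect p (int (last ks) - 1) (Grads p ks G) \<omega>))
     \<and>
    \<comment> \<open>the series read as sums of expectations; for \<open>n = 0\<close> nothing has to be assumed\<close>
     ((\<forall>d\<in>{1..n}. (\<lambda>ks. Expect p (\<lambda>\<omega>. Grads p ks F \<omega> * Grads p ks G \<omega>)) summable_on tuples d) \<and>
      (n > 0 \<longrightarrow>
        (\<lambda>ks. Expect p (\<lambda>\<omega>. Grads p ks F \<omega> * CondExpect p (int (last ks) - 1) (Grads p ks G) \<omega>))
          summable_on tuples (n + 1))
      \<longrightarrow>
      (\<lambda>ks. Expect p (\<lambda>\<omega>. Grads p ks F \<omega> * CondExpect p (int (last ks) - 1) (Grads p ks G) \<omega>))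
        summable_on tuples (n + 1) \<and>
      Cov p F G =
        (\<Sum>d=1..n. (-1) ^ (d + 1) *
           (\<Sum>\<^sub>\<infinity>ks\<in>tuples d. Expect p (\<lambda>\<omega>. Grads p ks F \<omega> * Grads p ks G \<omega>)))
        + (-1) ^ n *
           (\<Sum>\<^sub>\<infinity>ks\<in>tuples (n + 1).
             Expect p (\<lambda>\<omega>. Grads p ks F \<omega> * CondExpect p (int (last ks) - 1) (Grads p ks G) \<omega>)))"
proof -
  interpret coin_tossing p by (rule coin_tossing.intro) (rule assms(1))
  note F = assms(2) and G = assms(3)
  have T_eq: "tuples (n + 1) = tuples (Suc n)" by simp
  show ?thesis
    unfolding T_eq
  proof (intro conjI impI; elim conjE)
    assume S: "\<forall>d\<in>{1..n}. (\<lambda>ks. Expect p (\<lambda>\<omega>. \<bar>Grads p ks F \<omega> * Grads p ks G \<omega>\<bar>)) summable_on tuples d"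
      and T: "(\<lambda>ks. Expect p (\<lambda>\<omega>. \<bar>Grads p ks F \<omega> * CondExpect p (int (last ks) - 1) (Grads p ks G) \<omega>\<bar>))
        summable_on tuples (Suc n)"
    note S' = Expect_infsum[OF L2_Grads[OF F] L2_Grads[OF G] bspec[OF S]]
    note T' = Expect_infsum[OF L2_Grads[OF F] L2_cond[OF L2_Grads[OF G]] T]
    show "Cov p F G =
        (\<Sum>d=1..n. (-1) ^ (d + 1) *
           Expect p (\<lambda>\<omega>. \<Sum>\<^sub>\<infinity>ks\<in>tuples d. Grads p ks F \<omega> * Grads p ks G \<omega>))
        + (-1) ^ n *
           Expect p (\<lambda>\<omega>. \<Sum>\<^sub>\<infinity>ks\<in>tuples (Suc n).
             Grads p ks F \<omega> * CondExpect p (int (last ks) - 1) (Grads p ks G) \<omega>)"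
      using Cov_expansion[OF F G S'(1) T'(1)] T'(2) S'(2) by simp
  next
    assume S: "\<forall>d\<in>{1..n}. grad_prod F G summable_on tuples d"
      and T: "n > 0 \<longrightarrow> grad_cond_prod F G summable_on tuples (Suc n)"
    show T': "grad_cond_prod F G summable_on tuples (Suc n)"
      using T has_sum_imp_summable[OF grad_cond_prod_has_sum_Cov[OF F G]] by (cases n) auto
    show "Cov p F G = (\<Sum>d=1..n. (-1) ^ (d + 1) * infsum (grad_prod F G) (tuples d)) +
        (-1) ^ n * infsum (grad_cond_prod F G) (tuples (Suc n))"
      using S T' by (intro Cov_expansion F G) auto
  qed
qed

end
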